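(* Let $T,S:U\to U$ be diffeomorphisms of an open set $U\subseteq \mathbb{R}^{n}$. Suppose that $\mu\in \mathcal{P}(U)$ is $T$-invariant, that $\nu \in \mathcal{P}(U)$ is $S$-invariant, and that $\mathrm{supp}(\mu),\mathrm{supp}(\nu)\subseteq U$ are compact. Let $m\in\mathbb{N}$ satisfy $m > 2\max\{ d_{\mu},d_{\nu}\}$, and assume that the periodic points of $T$ and of $S$ with degree at most $m$ satisfy the periodic point assumption (stated in the context) on $\mathrm{supp}(\mu)$ and on $\mathrm{supp}(\nu)$, respectively. Then, for almost every $y\in C^1(U,\mathbb{R})$ (in the sense of prevalence), the following implication holds: if $\hat{\mu}_{(y,T)}^{(m+1)} = \hat{\nu}_{(y,S)}^{(m+1)}$, then the maps $T|_{\mathrm{supp}(\mu)}:\mathrm{supp}(\mu)\to\mathrm{supp}(\mu)$ and $S|_{\mathrm{supp}(\nu)}:\mathrm{supp}(\nu)\to\mathrm{supp}(\nu)$ are topologically conjugate.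
   Context: $\mathcal{P}(X)$ denotes the Borel probability measures on a Polish space $X$. The support $\mathrm{supp}(\mu)$ is the unique closed set $C\subseteq X$ with $\mu(C)=1$ that is contained in every closed set of full $\mu$-measure. The pushforward is $(f\#\mu)(B)=\mu(f^{-1}(B))$; $\mu$ is $T$-invariant if $T\#\mu=\mu$. (If $T$ is continuous, $\mu$ is $T$-invariant and $\mathrm{supp}(\mu)$ is compact, then $T(\mathrm{supp}(\mu))=\mathrm{supp}(\mu)$, so $T$ restricts to a self-map of $\mathrm{supp}(\mu)$.) A diffeomorphism is a $C^1$ bijection with $C^1$ inverse. Box dimension: for a bounded set $A\subseteq\mathbb{R}^n$, $\mathrm{boxdim}(A)=\lim_{\varepsilon\to0}\frac{\log N(\varepsilon)}{\log(1/\varepsilon)}$, where $N(\varepsilon)$ is the number of boxes of side-length $\varepsilon$ required to cover $A$ (the limit is understood to exist wherever this notation is used). Write $d_\mu:=\mathrm{boxdim}(\mathrm{supp}(\mu))$. Periodic point assumption: for a diffeomorphism $T:U\to U$, a compact set $A\subseteq U$ and $m\in\mathbb{N}$, the periodic points of $T$ with degree at most $m$ satisfy the periodic point assumption on $A$ if for each $1\le p\le m$: (1) the set $A_p=\{x\in A: T^p(x)=x\}$ of $p$-periodic points satisfies $\mathrm{boxdim}(A_p)<p/2$ (vacuous if $A_p$ is empty); (2) the linearization $DT^p$ of each such periodic orbit has distinct eigenvalues, i.e. for each $x\in A_p$ the $n\times n$ matrix $DT^p(x)$ has $n$ distinct (complex) eigenvalues. Delay coordinates: for $T:U\to U$, $y:U\to\mathbb{R}$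 and $k\in\mathbb{N}$, the time-delay map is $\Psi^{(k)}_{(y,T)}(x)=(y(x),y(T(x)),\dots,y(T^{k-1}(x)))\in\mathbb{R}^k$, and the delay-coordinate invariant measure is $\hat\mu^{(k)}_{(y,T)}:=\Psi^{(k)}_{(y,T)}\#\mu\in\mathcal{P}(\mathbb{R}^k)$. Topological conjugacy: continuous maps $F:X\to X$ and $G:Y\to Y$ are topologically conjugate if there is a homeomorphism $h:X\to Y$ with $G=h\circ F\circ h^{-1}$. Prevalence: a Borel subset $\mathcal{S}$ of a completely metrizable topological vector space $V$ is prevalent if there is a finite-dimensional subspace $E\subseteq V$ (a probe space) such that for every $v\in V$, $v+e\in \mathcal{S}$ for Lebesgue-almost every $e\in E$ (Lebesgue measure on $E$ taken via coordinates in any basis). A property holds for almost every $v\in V$ if it holds for all $v$ in some prevalent set. The space $C^1(U,\mathbb{R}^k)$ carries the topology of uniform convergence on compact subsets of $U$ of functions and their first partial derivatives; this makes it a completely metrizable topological vector space. *)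

theory Defs
  imports "HOL-Probability.Probability" "HOL-Library.Function_Algebras"
begin

section \<open>Borel probability measures, support, invariance\<close>

definition borel_prob_on :: "'a::topological_space set \<Rightarrow> 'a measure \<Rightarrow> bool" where
  "borel_prob_on X M \<longleftrightarrow> prob_space M \<and> space M = X \<and> sets M = sets (restrict_space borel X)"

text \<open>Closedness is relative to the space carrying the measure.\<close>

definition is_support :: "'a::topological_space measure \<Rightarrow> 'a set \<Rightarrow> bool" where
  "is_support M C \<longleftrightarrow> closedin (top_of_set (space M)) C \<and> emeasure M C = 1 \<and>
     (\<forall>D. closedin (top_of_set (space M)) D \<and> emeasure M D = 1 \<longrightarrow> C \<subseteq> D)"

definition supp :: "'a::topological_space measure \<Rightarrow> 'a set" where
  "supp M = (THE C. is_support M C)"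

definition invariant_measure :: "('a \<Rightarrow> 'a) \<Rightarrow> 'a measure \<Rightarrow> bool" where
  "invariant_measure T M \<longleftrightarrow> T \<in> measurable M M \<and> distr M M T = M"

lemma is_support_unique: "is_support M C \<Longrightarrow> is_support M D \<Longrightarrow> C = D"
  unfolding is_support_def by (meson subset_antisym)

lemma is_support_supp:
  fixes M :: "'a::second_countable_topology measure"
  assumes "borel_prob_on X M"
  shows "is_support M (supp M)"
proof -
  interpret prob_space M using assms by (simp add: borel_prob_on_def)
  have X: "space M = X" and sM: "sets M = sets (restrict_space borel X)"
    using assms by (auto simp: borel_prob_on_def)
  have meas: "X \<inter> W \<in> sets M" if "open W" for W
    using that by (auto simp: sM sets_restrict_space)
  define \<G> where "\<G> = {W. open W \<and> emeasure M (X \<inter> W) = 0}"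
  obtain \<H> where \<H>: "\<H> \<subseteq> \<G>" "countable \<H>" "\<Union>\<H> = \<Union>\<G>"
    using Lindelof[of \<G>] by (auto simp: \<G>_def)
  have null: "emeasure M (X \<inter> \<Union>\<G>) = 0"
  proof -
    have "(\<Union>W\<in>\<H>. X \<inter> W) \<in> null_sets M"
      using \<H> meas by (intro null_sets_UN') (auto simp: \<G>_def null_sets_def)
    then show ?thesis using \<H>(3) by (metis Int_Union null_setsD1)
  qed
  have op: "open (\<Union>\<G>)" by (auto simp: \<G>_def)
  have one: "emeasure M (X - W) = 1 \<longleftrightarrow> emeasure M (X \<inter> W) = 0" if "open W" for W
  proof -
    have "X - W = space M - X \<inter> W" using X by auto
    then show ?thesis
      using prob_compl[OF meas[OF that]] by (auto simp: emeasure_eq_measure)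
  qed
  have "is_support M (X - \<Union>\<G>)"
    unfolding is_support_def X
  proof (intro conjI allI impI)
    show "closedin (top_of_set X) (X - \<Union>\<G>)"
      using op by (metis Diff_Diff_Int Diff_subset closedin_def openin_open_Int
          topspace_euclidean_subtopology)
    show "emeasure M (X - \<Union>\<G>) = 1" using one[OF op] null by simp
    fix D assume D: "closedin (top_of_set X) D \<and> emeasure M D = 1"
    then obtain W where W: "open W" "X - D = X \<inter> W"
      by (auto simp: closedin_def openin_open)
    have "D = X - W" using D W(2) closedin_imp_subset by fastforce
    then have "W \<in> \<G>" using D one[OF W(1)] W(1) by (simp add: \<G>_def)
    then show "X - \<Union>\<G> \<subseteq> D" using \<open>D = X - W\<close> by auto
  qed
  then show ?thesis
    unfolding supp_def by (metis theI is_support_unique)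
qed


section \<open>Maps of class C1\<close>

definition C1_on :: "'a::real_normed_vector set \<Rightarrow> ('a \<Rightarrow> 'b::real_normed_vector) \<Rightarrow> bool" where
  "C1_on U f \<longleftrightarrow> (\<exists>f' :: 'a \<Rightarrow> 'a \<Rightarrow>\<^sub>L 'b.
     (\<forall>x\<in>U. (f has_derivative blinfun_apply (f' x)) (at x)) \<and> continuous_on U f')"

definition C1_diffeo :: "'a::real_normed_vector set \<Rightarrow> ('a \<Rightarrow> 'a) \<Rightarrow> bool" where
  "C1_diffeo U T \<longleftrightarrow> bij_betw T U U \<and> C1_on U T \<and> C1_on U (inv_into U T)"


section \<open>Box dimension\<close>

definition box_number :: "real \<Rightarrow> (real ^ 'n) set \<Rightarrow> nat" where
  "box_number e A = (LEAST k. \<exists>F. finite F \<and> card F = k \<and> A \<subseteq> (\<Union>a\<in>F. cbox a (a + vec e)))"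

text \<open>\<open>has_boxdim A d\<close> asserts that the limit exists and that it equals \<open>d\<close>.\<close>

definition has_boxdim :: "(real ^ 'n) set \<Rightarrow> real \<Rightarrow> bool" where
  "has_boxdim A d \<longleftrightarrow> bounded A \<and>
     ((\<lambda>e. ln (real (box_number e A)) / ln (1 / e)) \<longlongrightarrow> d) (at_right 0)"


section \<open>Periodic point assumption\<close>

definition complex_eigenvalues :: "real ^ 'n ^ 'n \<Rightarrow> complex set" where
  "complex_eigenvalues A =
     {l. \<exists>v :: complex ^ 'n. v \<noteq> 0 \<and> map_matrix complex_of_real A *v v = l *s v}"

definition periodic_points :: "('a \<Rightarrow> 'a) \<Rightarrow> 'a set \<Rightarrow> nat \<Rightarrow> 'a set" where
  "periodic_points T A p = {x \<in> A. (T ^^ p) x = x}"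

definition periodic_point_assumption ::
    "(real ^ 'n \<Rightarrow> real ^ 'n) \<Rightarrow> nat \<Rightarrow> (real ^ 'n) set \<Rightarrow> bool" where
  "periodic_point_assumption T m A \<longleftrightarrow> (\<forall>p\<in>{1..m}.
     (periodic_points T A p = {} \<or>
       (\<exists>d. has_boxdim (periodic_points T A p) d \<and> d < real p / 2)) \<and>
     (\<forall>x\<in>periodic_points T A p.
       card (complex_eigenvalues (jacobian (T ^^ p) (at x))) = CARD('n)))"


section \<open>Delay coordinates\<close>

text \<open>Euclidean \<open>k\<close>-space is the set of extensional functions on \<open>{..<k}\<close>; since this index set is
  finite, the product of the Borel sigma-algebras is the Borel sigma-algebra.\<close>

definition delay_map :: "('a \<Rightarrow> real) \<Rightarrow> ('a \<Rightarrow> 'a) \<Rightarrow> nat \<Rightarrow> 'a \<Rightarrow> (nat \<Rightarrow> real)" where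
  "delay_map y T k x = (\<lambda>i\<in>{..<k}. y ((T ^^ i) x))"

definition delay_measure ::
    "('a \<Rightarrow> real) \<Rightarrow> ('a \<Rightarrow> 'a) \<Rightarrow> nat \<Rightarrow> 'a measure \<Rightarrow> (nat \<Rightarrow> real) measure" where
  "delay_measure y T k M = distr M (Pi\<^sub>M {..<k} (\<lambda>_. borel)) (delay_map y T k)"


section \<open>Topological conjugacy\<close>

definition topologically_conjugate ::
    "'a::topological_space set \<Rightarrow> ('a \<Rightarrow> 'a) \<Rightarrow> 'b::topological_space set \<Rightarrow> ('b \<Rightarrow> 'b) \<Rightarrow> bool" where
  "topologically_conjugate X F Y G \<longleftrightarrow>
     continuous_on X F \<and> F ` X \<subseteq> X \<and> continuous_on Y G \<and> G ` Y \<subseteq> Y \<and>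
     (\<exists>h h'. homeomorphism X Y h h' \<and> (\<forall>y\<in>Y. G y = h (F (h' y))))"


section \<open>Prevalence\<close>

instantiation "fun" :: (type, real_vector) real_vector
begin

definition "scaleR c f = (\<lambda>x. c *\<^sub>R f x)"

instance
  by standard (auto simp: scaleR_fun_def plus_fun_def scaleR_add_right scaleR_add_left)

end

text \<open>The topological vector space is given by a topology whose carrier is a linear subspace of the
  ambient type. \<open>B\<close> is a basis of the probe space \<open>span B\<close>, and \<open>c\<close> ranges over coordinate vectors
  with respect to \<open>B\<close>.\<close>

definition prevalent_in :: "'v::real_vector topology \<Rightarrow> 'v set \<Rightarrow> bool" where
  "prevalent_in X S \<longleftrightarrow> S \<in> sigma_sets (topspace X) {G. openin X G} \<and>
     (\<exists>B. finite B \<and> independent B \<and> span B \<subseteq> topspace X \<and>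
       (\<forall>v\<in>topspace X. AE c in Pi\<^sub>M B (\<lambda>_. lborel). v + (\<Sum>b\<in>B. c b *\<^sub>R b) \<in> S))"

definition almost_every_in :: "'v::real_vector topology \<Rightarrow> ('v \<Rightarrow> bool) \<Rightarrow> bool" where
  "almost_every_in X P \<longleftrightarrow> (\<exists>S. prevalent_in X S \<and> (\<forall>v\<in>S. P v))"


section \<open>The space of C1 functions on an open set\<close>

text \<open>A function on \<open>U\<close> is represented by its extension by zero.\<close>

definition C1_space :: "(real ^ 'n) set \<Rightarrow> (real ^ 'n \<Rightarrow> real) set" where
  "C1_space U = {f. C1_on U f \<and> (\<forall>x. x \<notin> U \<longrightarrow> f x = 0)}"

definition partial_deriv :: "'n \<Rightarrow> (real ^ 'n \<Rightarrow> real) \<Rightarrow> real ^ 'n \<Rightarrow> real" where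
  "partial_deriv i f x = frechet_derivative f (at x) (axis i 1)"

definition C1_nbhd ::
    "(real ^ 'n) set \<Rightarrow> (real ^ 'n) set \<Rightarrow> real \<Rightarrow> (real ^ 'n \<Rightarrow> real) \<Rightarrow> (real ^ 'n \<Rightarrow> real) set" where
  "C1_nbhd U K e f = {g \<in> C1_space U. \<forall>x\<in>K. \<bar>g x - f x\<bar> < e \<and>
     (\<forall>i. \<bar>partial_deriv i g x - partial_deriv i f x\<bar> < e)}"

definition C1_topology :: "(real ^ 'n) set \<Rightarrow> (real ^ 'n \<Rightarrow> real) topology" where
  "C1_topology U = topology (\<lambda>W. W \<subseteq> C1_space U \<and>
     (\<forall>f\<in>W. \<exists>K e. compact K \<and> K \<subseteq> U \<and> 0 < e \<and> C1_nbhd U K e f \<subseteq> W))"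

lemma openin_C1_topology:
  "openin (C1_topology U) W \<longleftrightarrow> W \<subseteq> C1_space U \<and>
     (\<forall>f\<in>W. \<exists>K e. compact K \<and> K \<subseteq> U \<and> 0 < e \<and> C1_nbhd U K e f \<subseteq> W)"
proof -
  let ?L = "\<lambda>W. W \<subseteq> C1_space U \<and>
     (\<forall>f\<in>W. \<exists>K e. compact K \<and> K \<subseteq> U \<and> 0 < e \<and> C1_nbhd U K e f \<subseteq> W)"
  have "istopology ?L"
    unfolding istopology_def
  proof (rule conjI; intro allI impI)
    fix V W assume V: "?L V" and W: "?L W"
    show "?L (V \<inter> W)"
    proof (intro conjI ballI)
      fix f assume f: "f \<in> V \<inter> W"
      obtain K e where 1: "compact K" "K \<subseteq> U" "0 < e" "C1_nbhd U K e f \<subseteq> V"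
        using V f by blast
      obtain L d where 2: "compact L" "L \<subseteq> U" "0 < d" "C1_nbhd U L d f \<subseteq> W"
        using W f by blast
      have "C1_nbhd U (K \<union> L) (min e d) f \<subseteq> C1_nbhd U K e f \<inter> C1_nbhd U L d f"
        by (auto simp: C1_nbhd_def)
      with 1 2 show "\<exists>K e. compact K \<and> K \<subseteq> U \<and> 0 < e \<and> C1_nbhd U K e f \<subseteq> V \<inter> W"
        by (intro exI[of _ "K \<union> L"] exI[of _ "min e d"]) auto
    qed (use V in auto)
  next
    fix \<K> assume "\<forall>V\<in>\<K>. ?L V"
    then show "?L (\<Union>\<K>)" by (meson UnionE Union_least Union_upper subset_trans)
  qed
  then show ?thesis by (simp add: C1_topology_def)
qed

lemma topspace_C1_topology: "topspace (C1_topology U) = C1_space U"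
proof
  show "topspace (C1_topology U) \<subseteq> C1_space U"
    using openin_C1_topology openin_topspace by blast
  have "C1_nbhd U {} 1 f \<subseteq> C1_space U" for f by (auto simp: C1_nbhd_def)
  then have "openin (C1_topology U) (C1_space U)"
    unfolding openin_C1_topology
    by (metis compact_empty empty_subsetI order_refl zero_less_one)
  then show "C1_space U \<subseteq> topspace (C1_topology U)" by (rule openin_subset)
qed

end

theory Submission
  imports Defs
begin

text \<open>The heart of the matter is an injectivity theorem of Takens type: for almost every observable
  \<open>y\<close>, the \<open>m\<close>-fold delay map is injective on the support. The probe space consists of polynomials,
  which interpolate arbitrary values at any \<open>2 m\<close> points. For a pair \<open>(x, x')\<close> the differences
  \<open>y (T\<^sup>i x) - y (T\<^sup>i x')\<close> are affine in the coefficients of the perturbation of \<open>y\<close>, and the number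
  \<open>r\<close> of independent ones exceeds the box dimension of the set of pairs of the given orbit type.
  The coefficients for which \<open>r\<close> differences are smaller than \<open>\<epsilon>\<close> have measure \<open>O(\<epsilon>\<^sup>r)\<close>, while
  fewer than \<open>\<epsilon>\<^sup>-\<^sup>s\<close> sets of size \<open>\<epsilon>\<close>, with \<open>s < r\<close>, cover these pairs; so almost no coefficients
  let a pair collide.

  If the delay measures of length \<open>m + 1\<close> agree, then so do the images of the two supports under the
  delay maps. Injectivity of the delay maps of length \<open>m\<close> yields a homeomorphism of the supports,
  and it intertwines the dynamics because the shift of a delay vector is the delay vector of the image
  point.\<close>

section \<open>Affine systems with random coefficients\<close>

text \<open>The supports may be arbitrary compact sets, so no tangent spaces or transversality are
  at hand, only covers and locally Lipschitz maps that transport them. The obstacle is that the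
  differences belonging to a pair may be dependent. Points are sorted by minimal period, capped at
  \<open>m\<close>; class \<open>p\<close> has dimension below \<open>p / 2\<close>. Take classes
  \<open>p \<le> q\<close>. If the first \<open>q\<close> iterates of the two points do not meet,
  the orbit in class \<open>q\<close> supplies \<open>q\<close> independent differences, against a
  dimension below \<open>p / 2 + q / 2 \<le> q\<close>. If one point is the \<open>j\<close>-th
  iterate of the other, one point determines the pair and the dimension is below
  \<open>p / 2\<close>. Here no more than half can be hoped for: with period
  \<open>p = 2 * j\<close>, the differences at \<open>i\<close> and \<open>i + j\<close> are
  opposite. The bound \<open>p / 2\<close> in the periodic point assumption fits both counts. One
  probe space serves both maps, since it depends on \<open>U\<close> and \<open>m\<close> only.
  Prevalence also asks for a Borel set, and the set of \<open>y\<close> that satisfy the implication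
  has no evident measurability; joint injectivity of the two delay maps is a countable intersection
  of open conditions.\<close>

lemma distr_PiM_lborel_translate:
  fixes t :: "'b \<Rightarrow> real"
  assumes "finite B"
  defines "L \<equiv> Pi\<^sub>M B (\<lambda>_. lborel :: real measure)"
  shows "distr L L (\<lambda>c. \<lambda>b\<in>B. c b + t b) = L"
proof -
  interpret product_sigma_finite "\<lambda>_ :: 'b. lborel :: real measure" by standard
  have meas: "(\<lambda>c. \<lambda>b\<in>B. c b + t b) \<in> measurable L L"
    unfolding L_def by (intro measurable_restrict borel_measurable_add) (auto intro!: measurable_component_singleton)
  show ?thesis unfolding L_def
  proof (rule PiM_eqI)
    fix A :: "'b \<Rightarrow> real set" assume A: "\<And>i. i \<in> B \<Longrightarrow> A i \<in> sets lborel"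
    have eq: "(\<lambda>c. \<lambda>b\<in>B. c b + t b) -` Pi\<^sub>E B A \<inter> space L = Pi\<^sub>E B (\<lambda>b. (+) (t b) -` A b)"
      by (auto simp: L_def space_PiM PiE_def Pi_def extensional_def restrict_def add.commute)
    have sh: "emeasure lborel ((+) (t b) -` A b) = emeasure lborel (A b)"
         "(+) (t b) -` A b \<in> sets lborel" if "b \<in> B" for b
    proof -
      have "emeasure lborel (A b) = emeasure (distr lborel borel ((+) (t b))) (A b)"
        by (simp add: lborel_distr_plus)
      also have "\<dots> = emeasure lborel ((+) (t b) -` A b)"
        using A[OF that] by (subst emeasure_distr) auto
      finally show "emeasure lborel ((+) (t b) -` A b) = emeasure lborel (A b)" by simp
      have "(+) (t b) \<in> borel_measurable borel" by simp
      then show "(+) (t b) -` A b \<in> sets lborel" 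
        using A[OF that] measurable_sets[of "(+) (t b)" borel borel "A b"] by auto
    qed
    have "emeasure (distr L L (\<lambda>c. \<lambda>b\<in>B. c b + t b)) (Pi\<^sub>E B A) = emeasure L (Pi\<^sub>E B (\<lambda>b. (+) (t b) -` A b))"
      using A assms(1) meas
      by (subst emeasure_distr) (auto simp: eq[unfolded L_def] L_def intro!: sets_PiM_I_finite)
    also have "\<dots> = (\<Prod>b\<in>B. emeasure lborel (A b))"
      using sh assms(1) by (simp add: L_def emeasure_PiM)
    finally show "emeasure (distr (Pi\<^sub>M B (\<lambda>_. lborel)) (Pi\<^sub>M B (\<lambda>_. lborel)) (\<lambda>c. \<lambda>b\<in>B. c b + t b)) (Pi\<^sub>E B A)
       = (\<Prod>b\<in>B. emeasure lborel (A b))" by (simp add: L_def)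
  qed (use assms in auto)
qed

lemma emeasure_PiM_lborel_translate:
  fixes t :: "'b \<Rightarrow> real"
  assumes "finite B" "E \<in> sets (Pi\<^sub>M B (\<lambda>_. lborel :: real measure))"
  shows "{c \<in> space (Pi\<^sub>M B (\<lambda>_. lborel)). (\<lambda>b\<in>B. c b + t b) \<in> E} \<in> sets (Pi\<^sub>M B (\<lambda>_. lborel))"
    and "emeasure (Pi\<^sub>M B (\<lambda>_. lborel)) {c \<in> space (Pi\<^sub>M B (\<lambda>_. lborel)). (\<lambda>b\<in>B. c b + t b) \<in> E}
      = emeasure (Pi\<^sub>M B (\<lambda>_. lborel)) E"
proof -
  let ?L = "Pi\<^sub>M B (\<lambda>_. lborel :: real measure)"
  have meas: "(\<lambda>c. \<lambda>b\<in>B. c b + t b) \<in> measurable ?L ?L"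
    by (intro measurable_restrict borel_measurable_add) (auto intro!: measurable_component_singleton)
  have eq: "{c \<in> space ?L. (\<lambda>b\<in>B. c b + t b) \<in> E} = (\<lambda>c. \<lambda>b\<in>B. c b + t b) -` E \<inter> space ?L"
    by auto
  show "{c \<in> space ?L. (\<lambda>b\<in>B. c b + t b) \<in> E} \<in> sets ?L"
    unfolding eq using measurable_sets[OF meas assms(2)] .
  have "emeasure ?L E = emeasure (distr ?L ?L (\<lambda>c. \<lambda>b\<in>B. c b + t b)) E"
    by (simp add: distr_PiM_lborel_translate[OF assms(1)])
  also have "\<dots> = emeasure ?L {c \<in> space ?L. (\<lambda>b\<in>B. c b + t b) \<in> E}"
    unfolding eq by (rule emeasure_distr[OF meas assms(2)])
  finally show "emeasure ?L {c \<in> space ?L. (\<lambda>b\<in>B. c b + t b) \<in> E} = emeasure ?L E" ..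
qed

text \<open>Since \<open>\<gamma>\<close> is nearly dual to the rows of \<open>M\<close>, the translates of the slab by the vectors
  \<open>5 e (\<Sum>l. k l \<gamma> l)\<close>, where \<open>k\<close> has natural entries below \<open>1 / e\<close>, are pairwise disjoint.
  There are about \<open>e ^ (-r)\<close> of them and they all lie in a fixed box, which bounds the measure of
  each.\<close>

lemma measure_slab_le:
  fixes B :: "'b set" and r :: nat and \<gamma> :: "nat \<Rightarrow> 'b \<Rightarrow> real" and R :: real
  assumes "finite B"
  defines "L \<equiv> Pi\<^sub>M B (\<lambda>_. lborel :: real measure)"
  obtains C :: real where "C \<ge> 0"
    "\<And>a M e. 0 < e \<Longrightarrow> e \<le> 1 \<Longrightarrow>
      (\<And>i k. i < r \<Longrightarrow> k < r \<Longrightarrow>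
        real r * \<bar>(\<Sum>b\<in>B. \<gamma> k b * M i b) - (if i = k then 1 else 0)\<bar> \<le> 1/2) \<Longrightarrow>
      {c \<in> space L. (\<forall>b\<in>B. \<bar>c b\<bar> \<le> R) \<and> (\<forall>i<r. \<bar>a i + (\<Sum>b\<in>B. c b * M i b)\<bar> \<le> e)} \<in> sets L \<and>
      emeasure L {c \<in> space L. (\<forall>b\<in>B. \<bar>c b\<bar> \<le> R) \<and> (\<forall>i<r. \<bar>a i + (\<Sum>b\<in>B. c b * M i b)\<bar> \<le> e)}
        \<le> ennreal (C * e ^ r)"
proof -
  interpret product_sigma_finite "\<lambda>_ :: 'b. lborel :: real measure" by standard
  define \<Gamma> where "\<Gamma> = (\<Sum>l<r. \<Sum>b\<in>B. \<bar>\<gamma> l b\<bar>)"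
  \<comment> \<open>The shifts \<open>t k\<close> below are at most
    \<open>5 * e * (2 / e) * \<Gamma>\<close>, so every translate stays in the box of half-side
    \<open>R'\<close>. Hence \<open>C\<close> does not depend on \<open>a\<close>, \<open>M\<close>
    or \<open>e\<close>.\<close>
  define R' where "R' = \<bar>R\<bar> + 10 * \<Gamma>"
  define C where "C = (2 * R') ^ card B"
  have \<Gamma>0: "\<Gamma> \<ge> 0" unfolding \<Gamma>_def by (intro sum_nonneg) auto
  have R'0: "R' \<ge> 0" using \<Gamma>0 by (simp add: R'_def)
  have box: "Pi\<^sub>E B (\<lambda>_. {-R'..R'}) \<in> sets L" "emeasure L (Pi\<^sub>E B (\<lambda>_. {-R'..R'})) = ennreal C"
    using assms(1) R'0 by (auto simp: L_def C_def emeasure_PiM ennreal_power intro!: sets_PiM_I_finite)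
  show ?thesis
  proof (rule that[of C])
    show "C \<ge> 0" using R'0 by (simp add: C_def)
    fix a M and e :: real
    assume e: "0 < e" "e \<le> 1"
     and near: "\<And>i k. i < r \<Longrightarrow> k < r \<Longrightarrow>
        real r * \<bar>(\<Sum>b\<in>B. \<gamma> k b * M i b) - (if i = k then 1 else 0)\<bar> \<le> 1/2"
    let ?w = "\<lambda>i c. a i + (\<Sum>b\<in>B. c b * M i b)"
    define E where "E = {c \<in> space L. (\<forall>b\<in>B. \<bar>c b\<bar> \<le> R) \<and> (\<forall>i<r. \<bar>?w i c\<bar> \<le> e)}"
    have Emeas: "E \<in> sets L"
    proof -
      have c: "(\<lambda>c. c b) \<in> borel_measurable L" if "b \<in> B" for b
        using that unfolding L_def by (auto intro!: measurable_component_singleton)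
      have w: "(\<lambda>c. ?w i c) \<in> borel_measurable L" for i
        by (intro borel_measurable_add borel_measurable_sum borel_measurable_times c) auto
      have 1: "{c \<in> space L. \<forall>b\<in>B. \<bar>c b\<bar> \<le> R} \<in> sets L"
        using assms(1) c by (intro sets.sets_Collect_finite_All) (auto intro!: borel_measurable_le)
      have 2: "{c \<in> space L. \<forall>i\<in>{..<r}. \<bar>?w i c\<bar> \<le> e} \<in> sets L"
        using w by (intro sets.sets_Collect_finite_All) (auto intro!: borel_measurable_le)
      have "E = {c \<in> space L. \<forall>b\<in>B. \<bar>c b\<bar> \<le> R} \<inter> {c \<in> space L. \<forall>i\<in>{..<r}. \<bar>?w i c\<bar> \<le> e}"
        by (auto simp: E_def)
      then show ?thesis using 1 2 by auto
    qed
    define n where "n = nat \<lceil>1 / e\<rceil>"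
    have n: "real n \<ge> 1 / e" "real n \<le> 2 / e"
    proof -
      show "real n \<ge> 1 / e" unfolding n_def by linarith
      have "1 / e \<ge> 1" using e by simp
      then have "real n \<le> 1 / e + 1 / e" unfolding n_def by linarith
      then show "real n \<le> 2 / e" by simp
    qed
    define K where "K = Pi\<^sub>E {..<r} (\<lambda>_. {..<n})"
    have cardK: "card K = n ^ r" "finite K"
      by (auto simp: K_def card_PiE intro!: finite_PiE)
    \<comment> \<open>Translates must lie further apart than the slab width \<open>2 * e\<close>.
      Near-duality may halve a shift, so the factor has to exceed 4; with 5 the gap is at least
      \<open>5/2 * e\<close>.\<close>
    define t where "t k b = 5 * e * (\<Sum>l<r. real (k l) * \<gamma> l b)" for k :: "nat \<Rightarrow> nat" and b
    have t_le: "\<bar>t k b\<bar> \<le> 10 * \<Gamma>" if "k \<in> K" "b \<in> B" for k b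
    proof -
      have "\<bar>\<Sum>l<r. real (k l) * \<gamma> l b\<bar> \<le> (\<Sum>l<r. real n * \<bar>\<gamma> l b\<bar>)"
        using that by (intro order_trans[OF sum_abs] sum_mono)
          (auto simp: abs_mult K_def PiE_def Pi_def less_imp_le intro!: mult_right_mono)
      also have "\<dots> = real n * (\<Sum>l<r. \<bar>\<gamma> l b\<bar>)" by (simp add: sum_distrib_left)
      also have "\<dots> \<le> real n * \<Gamma>" unfolding \<Gamma>_def
        using that assms(1) by (intro mult_left_mono sum_mono member_le_sum) auto
      finally have "\<bar>t k b\<bar> \<le> 5 * e * (real n * \<Gamma>)"
        using e by (auto simp: t_def abs_mult)
      also have "\<dots> \<le> 5 * e * (2 / e * \<Gamma>)" using e n \<Gamma>0 by (intro mult_left_mono mult_right_mono) auto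
      also have "\<dots> = 10 * \<Gamma>" using e by simp
      finally show ?thesis .
    qed
    define X where "X k = {c \<in> space L. (\<lambda>b\<in>B. c b + t k b) \<in> E}" for k
    have X: "X k \<in> sets L" "emeasure L (X k) = emeasure L E" for k
      using emeasure_PiM_lborel_translate[OF assms(1) Emeas[unfolded L_def], of "t k"]
      by (auto simp: X_def L_def)
    have Xbox: "X k \<subseteq> Pi\<^sub>E B (\<lambda>_. {-R'..R'})" if "k \<in> K" for k
    proof
      fix c assume c: "c \<in> X k"
      have "\<bar>c b\<bar> \<le> R'" if "b \<in> B" for b
      proof -
        have "\<bar>c b + t k b\<bar> \<le> R" using c that by (auto simp: X_def E_def)
        then show ?thesis using t_le[OF \<open>k \<in> K\<close> that] by (auto simp: R'_def)
      qed
      then have "c b \<in> {-R'..R'}" if "b \<in> B" for b using that by (force simp: abs_le_iff)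
      then show "c \<in> Pi\<^sub>E B (\<lambda>_. {-R'..R'})" using c by (auto simp: X_def L_def space_PiM PiE_def)
    qed
    have disj: "disjoint_family_on X K"
      unfolding disjoint_family_on_def
    proof (intro ballI impI, rule ccontr)
      fix k k' assume k: "k \<in> K" "k' \<in> K" "k \<noteq> k'" and ne: "X k \<inter> X k' \<noteq> {}"
      then obtain c where c: "c \<in> X k" "c \<in> X k'" by auto
      have "\<exists>l<r. k l \<noteq> k' l"
      proof (rule ccontr)
        assume "\<not> ?thesis"
        then have "k = k'" using k by (intro PiE_ext[of k "{..<r}" _ k']) (auto simp: K_def)
        with k show False by simp
      qed
      define d where "d l = real (k l) - real (k' l)" for l
      \<comment> \<open>The row where \<open>k\<close> and \<open>k'\<close> differ most is the one
        to inspect: there the near-duality errors, each at most \<open>D / (2 * r)\<close>, add up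
        to no more than half of the diagonal term.\<close>
      define D where "D = Max ((\<lambda>l. \<bar>d l\<bar>) ` {..<r})"
      obtain l0 where l0: "l0 < r" "k l0 \<noteq> k' l0" using \<open>\<exists>l<r. k l \<noteq> k' l\<close> by auto
      have ne': "(\<lambda>l. \<bar>d l\<bar>) ` {..<r} \<noteq> {}" using l0 by auto
      have Dge: "\<bar>d l\<bar> \<le> D" if "l < r" for l unfolding D_def using that by (intro Max_ge) auto
      have "\<bar>d l0\<bar> \<ge> 1" using l0 unfolding d_def by linarith
      then have D1: "D \<ge> 1" using Dge[OF l0(1)] by linarith
      obtain i where i: "i < r" "\<bar>d i\<bar> = D" 
        using Max_in[OF _ ne'] by (auto simp: D_def)
      have w: "?w i (\<lambda>b\<in>B. c b + t q b) = ?w i c + 5 * e * (\<Sum>l<r. real (q l) * (\<Sum>b\<in>B. \<gamma> l b * M i b))" for q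
      proof -
        have "(\<Sum>b\<in>B. t q b * M i b) = 5 * e * (\<Sum>b\<in>B. \<Sum>l<r. real (q l) * (\<gamma> l b * M i b))"
          by (simp add: t_def sum_distrib_left sum_distrib_right algebra_simps)
        also have "\<dots> = 5 * e * (\<Sum>l<r. real (q l) * (\<Sum>b\<in>B. \<gamma> l b * M i b))"
          by (subst sum.swap) (simp add: sum_distrib_left)
        finally show ?thesis by (simp add: distrib_right sum.distrib)
      qed
      have "\<bar>?w i (\<lambda>b\<in>B. c b + t k b)\<bar> \<le> e" "\<bar>?w i (\<lambda>b\<in>B. c b + t k' b)\<bar> \<le> e"
        using c i by (auto simp: X_def E_def)
      then have le: "\<bar>?w i (\<lambda>b\<in>B. c b + t k b) - ?w i (\<lambda>b\<in>B. c b + t k' b)\<bar> \<le> 2 * e" by linarith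
      have eq: "?w i (\<lambda>b\<in>B. c b + t k b) - ?w i (\<lambda>b\<in>B. c b + t k' b)
        = 5 * e * (\<Sum>l<r. d l * (\<Sum>b\<in>B. \<gamma> l b * M i b))"
        unfolding w by (simp add: d_def left_diff_distrib sum_subtractf algebra_simps)
      let ?\<eta> = "\<lambda>l. (\<Sum>b\<in>B. \<gamma> l b * M i b) - (if i = l then 1 else 0)"
      have "(\<Sum>l<r. d l * (\<Sum>b\<in>B. \<gamma> l b * M i b)) = (\<Sum>l<r. (if l = i then d l else 0) + d l * ?\<eta> l)"
        by (intro sum.cong) (auto simp: algebra_simps)
      also have "\<dots> = d i + (\<Sum>l<r. d l * ?\<eta> l)"
        using i by (simp add: sum.distrib)
      finally have s: "(\<Sum>l<r. d l * (\<Sum>b\<in>B. \<gamma> l b * M i b)) = d i + (\<Sum>l<r. d l * ?\<eta> l)" .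
      have r0: "real r > 0" using i by auto
      have "\<bar>\<Sum>l<r. d l * ?\<eta> l\<bar> \<le> (\<Sum>l<r. D * (1 / (2 * real r)))"
      proof (intro order_trans[OF sum_abs] sum_mono)
        fix l assume "l \<in> {..<r}"
        then have l: "l < r" by simp
        have "\<bar>?\<eta> l\<bar> \<le> 1 / (2 * real r)" using near[OF i(1) l] r0 by (simp add: field_simps)
        then show "\<bar>d l * ?\<eta> l\<bar> \<le> D * (1 / (2 * real r))"
          unfolding abs_mult using Dge[OF l] D1 by (intro mult_mono) auto
      qed
      also have "\<dots> = D / 2" using r0 by simp
      finally have "\<bar>d i + (\<Sum>l<r. d l * ?\<eta> l)\<bar> \<ge> D / 2" using i(2) by linarith
      then have "\<bar>5 * e * (d i + (\<Sum>l<r. d l * ?\<eta> l))\<bar> \<ge> 5 * e * (1/2)"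
        unfolding abs_mult using e D1 by (auto intro!: mult_left_mono)
      then show False using le e unfolding eq s by simp
    qed
    have "of_nat (n ^ r) * emeasure L E = (\<Sum>k\<in>K. emeasure L (X k))" using X cardK by simp
    also have "\<dots> = emeasure L (\<Union>k\<in>K. X k)"
      using X disj cardK by (intro sum_emeasure) auto
    also have "\<dots> \<le> emeasure L (Pi\<^sub>E B (\<lambda>_. {-R'..R'}))"
      using Xbox box by (intro emeasure_mono) auto
    finally have main: "of_nat (n ^ r) * emeasure L E \<le> ennreal C" using box by simp
    have n0: "n > 0" using n e by (metis divide_pos_pos not_le of_nat_0 of_nat_0_less_iff order.strict_trans2 zero_less_one)
    have "emeasure L E < \<infinity>"
    proof (rule ccontr)
      assume "\<not> ?thesis"
      then have "emeasure L E = \<infinity>" using top.not_eq_extremum by fastforce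
      then have "of_nat (n ^ r) * emeasure L E = \<infinity>" using n0 by (simp add: ennreal_mult_top)
      then show False using main by (simp add: top_unique)
    qed
    then obtain x where x: "x \<ge> 0" "emeasure L E = ennreal x" by (cases "emeasure L E") auto
    have "ennreal (real (n ^ r) * x) \<le> ennreal C"
      using main x by (simp add: ennreal_mult ennreal_of_nat_eq_real_of_nat)
    then have nx: "real n ^ r * x \<le> C" using \<open>C \<ge> 0\<close> by (simp add: ennreal_le_iff)
    have "(1 / e) ^ r * x \<le> real n ^ r * x" using n e x by (intro mult_right_mono power_mono) auto
    then have "(1 / e) ^ r * x \<le> C" using nx by linarith
    then have "x \<le> C * e ^ r" using e by (simp add: field_simps)
    then have "emeasure L E \<le> ennreal (C * e ^ r)" using x by (simp add: ennreal_leI)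
    then show "{c \<in> space L. (\<forall>b\<in>B. \<bar>c b\<bar> \<le> R) \<and> (\<forall>i<r. \<bar>a i + (\<Sum>b\<in>B. c b * M i b)\<bar> \<le> e)} \<in> sets L \<and>
      emeasure L {c \<in> space L. (\<forall>b\<in>B. \<bar>c b\<bar> \<le> R) \<and> (\<forall>i<r. \<bar>a i + (\<Sum>b\<in>B. c b * M i b)\<bar> \<le> e)}
        \<le> ennreal (C * e ^ r)" using Emeas by (simp add: E_def)
  qed
qed

text \<open>Vanishing \<open>r\<close>-dimensional lower Minkowski content.\<close>

definition thin :: "nat \<Rightarrow> 'a::metric_space set \<Rightarrow> bool" where
  "thin r Z \<longleftrightarrow> (\<forall>\<delta>>0. \<exists>F e. finite F \<and> Z \<subseteq> \<Union>F \<and> 0 < e \<and> e < \<delta> \<and>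
     (\<forall>S\<in>F. \<forall>x\<in>S. \<forall>y\<in>S. dist x y \<le> e) \<and> real (card F) * e ^ r < \<delta>)"

lemma thinD:
  assumes "thin r Z" "\<delta> > 0"
  shows "\<exists>F e. finite F \<and> Z \<subseteq> \<Union>F \<and> 0 < e \<and> e < \<delta> \<and>
     (\<forall>S\<in>F. \<forall>x\<in>S. \<forall>y\<in>S. dist x y \<le> e) \<and> real (card F) * e ^ r < \<delta>"
  using assms by (simp add: thin_def)

lemma thin_subset: "thin r Z \<Longrightarrow> Y \<subseteq> Z \<Longrightarrow> thin r Y"
  unfolding thin_def by (meson subset_trans)

lemma thin_lipschitz_image:
  assumes "thin r Z" and lip: "L-lipschitz_on Z f"
  shows "thin r (f ` Z)"
  unfolding thin_def
proof (intro allI impI)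
  fix \<delta> :: real assume \<delta>: "\<delta> > 0"
  \<comment> \<open>\<open>L\<close> may be 0, while the new scale \<open>L' * e\<close> must be
    positive.\<close>
  define L' where "L' = L + 1"
  have L: "L \<ge> 0" "L' > 0" using lipschitz_on_nonneg[OF lip] by (auto simp: L'_def)
  define \<delta>' where "\<delta>' = min (\<delta> / L') (\<delta> / L' ^ r)"
  have "\<delta>' > 0" using \<delta> L by (simp add: \<delta>'_def)
  obtain F e where F: "finite F" "Z \<subseteq> \<Union>F" "0 < e" "e < \<delta>'"
     "\<forall>S\<in>F. \<forall>x\<in>S. \<forall>y\<in>S. dist x y \<le> e" "real (card F) * e ^ r < \<delta>'"
    using thinD[OF assms(1) \<open>\<delta>' > 0\<close>] by (elim exE conjE) (rule that)
  \<comment> \<open>The Lipschitz bound holds on \<open>Z\<close> only, so each covering set is cut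
    down to \<open>Z\<close> before it is mapped.\<close>
  let ?F = "(\<lambda>S. f ` (S \<inter> Z)) ` F"
  have "real (card ?F) * (L' * e) ^ r \<le> real (card F) * (L' * e) ^ r"
    using F L card_image_le[OF F(1)] by (intro mult_right_mono) auto
  also have "\<dots> = L' ^ r * (real (card F) * e ^ r)" by (simp add: power_mult_distrib)
  also have "\<dots> < L' ^ r * (\<delta> / L' ^ r)" using F(6) L by (intro mult_strict_left_mono) (auto simp: \<delta>'_def)
  also have "\<dots> = \<delta>" using L by simp
  finally have 1: "real (card ?F) * (L' * e) ^ r < \<delta>" .
  have 2: "L' * e < \<delta>" using F(4) L by (simp add: \<delta>'_def field_simps)
  have 3: "dist x y \<le> L' * e" if S: "S \<in> ?F" and x: "x \<in> S" and y: "y \<in> S" for S x y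
  proof -
    obtain S' u v where uv: "S' \<in> F" "u \<in> S'" "u \<in> Z" "v \<in> S'" "v \<in> Z" "x = f u" "y = f v"
      using S x y by auto
    have "dist x y \<le> L * dist u v" using lipschitz_onD[OF lip] uv by simp
    also have "\<dots> \<le> L' * e" using F(5)[rule_format, OF uv(1,2,4)] L by (intro mult_mono) (auto simp: L'_def)
    finally show ?thesis .
  qed
  have 4: "f ` Z \<subseteq> \<Union>?F" using F(2) by auto
  show "\<exists>F e. finite F \<and> f ` Z \<subseteq> \<Union>F \<and> 0 < e \<and> e < \<delta> \<and>
     (\<forall>S\<in>F. \<forall>x\<in>S. \<forall>y\<in>S. dist x y \<le> e) \<and> real (card F) * e ^ r < \<delta>"
    by (rule exI[of _ ?F], rule exI[of _ "L' * e"]) (use F(1,3) L 1 2 3 4 in auto)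
qed

text \<open>The exceptional coefficients form a union over uncountably many pairs, whose
  measurability is not evident. Measurable supersets of small measure suffice, because a countable
  intersection of them is null.\<close>

lemma AE_I_outer_small:
  assumes "\<And>\<delta>. 0 < \<delta> \<Longrightarrow> \<exists>E\<in>sets M. {x \<in> space M. \<not> P x} \<subseteq> E \<and> emeasure M E \<le> ennreal \<delta>"
  shows "AE x in M. P x"
proof -
  have "\<forall>n. \<exists>E\<in>sets M. {x \<in> space M. \<not> P x} \<subseteq> E \<and> emeasure M E \<le> ennreal (1 / Suc n)"
    using assms by simp
  then obtain E where E: "\<And>n. E n \<in> sets M" "\<And>n. {x \<in> space M. \<not> P x} \<subseteq> E n"
     "\<And>n. emeasure M (E n) \<le> ennreal (1 / Suc n)" by metis
  let ?N = "\<Inter>n. E n"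
  have N: "?N \<in> sets M" using E(1) by (intro sets.countable_INT) auto
  have le: "emeasure M ?N \<le> ennreal (1 / Suc n)" for n
    by (rule order_trans[OF emeasure_mono E(3)]) (use E(1) in auto)
  have le': "emeasure M ?N \<le> 0 + ennreal \<delta>" if "\<delta> > 0" for \<delta>
  proof -
    obtain n where "1 / Suc n < \<delta>" using reals_Archimedean[OF \<open>\<delta> > 0\<close>] by (auto simp: inverse_eq_divide)
    then have "ennreal (1 / Suc n) \<le> ennreal \<delta>" by (intro ennreal_leI) simp
    then show ?thesis using order_trans[OF le[of n]] by simp
  qed
  have "emeasure M ?N \<le> 0" by (rule ennreal_le_epsilon) (rule le')
  then have "?N \<in> null_sets M" using N by (simp add: null_sets_def)
  then show ?thesis using E(2) by (intro AE_I') auto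
qed

text \<open>The covering argument on a patch where one Lipschitz constant and one nearly dual family
  serve all points. The Lipschitz constant of the affine expression in \<open>z\<close> grows with
  \<open>c\<close>, so \<open>c\<close> is first confined to a cube of half-side \<open>R\<close>;
  countably many cubes exhaust all coefficients.\<close>

lemma AE_affine_system_nonzero_aux:
  fixes B :: "'b set" and Z :: "'z::metric_space set"
    and a :: "nat \<Rightarrow> 'z \<Rightarrow> real" and M :: "nat \<Rightarrow> 'b \<Rightarrow> 'z \<Rightarrow> real"
  assumes fB: "finite B" and thin: "thin r Z" and L: "L \<ge> 0"
    and lipa: "\<And>i. i < r \<Longrightarrow> L-lipschitz_on Z (a i)"
    and lipM: "\<And>i b. i < r \<Longrightarrow> b \<in> B \<Longrightarrow> L-lipschitz_on Z (M i b)"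
    and near: "\<And>i k z. z \<in> Z \<Longrightarrow> i < r \<Longrightarrow> k < r \<Longrightarrow>
        real r * \<bar>(\<Sum>b\<in>B. \<gamma> k b * M i b z) - (if i = k then 1 else 0)\<bar> \<le> 1/2"
  shows "AE c in Pi\<^sub>M B (\<lambda>_. lborel). \<forall>z\<in>Z. \<exists>i<r. a i z + (\<Sum>b\<in>B. c b * M i b z) \<noteq> 0"
proof -
  let ?L = "Pi\<^sub>M B (\<lambda>_. lborel :: real measure)"
  have R: "AE c in ?L. (\<forall>b\<in>B. \<bar>c b\<bar> \<le> R) \<longrightarrow> (\<forall>z\<in>Z. \<exists>i<r. a i z + (\<Sum>b\<in>B. c b * M i b z) \<noteq> 0)"
    if R0: "R \<ge> 0" for R
  proof (rule AE_I_outer_small)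
    fix \<delta> :: real assume \<delta>: "\<delta> > 0"
    \<comment> \<open>For \<open>c\<close> in the cube the expressions vary by less than
      \<open>K * e\<close> over a set of diameter \<open>e\<close>, so a zero anywhere in the set
      puts \<open>c\<close> into the slab of width \<open>K * e\<close> at any chosen point of it.
      The summand 1 keeps \<open>K\<close> positive.\<close>
    define K where "K = L + card B * (R * L) + 1"
    have K: "K > 0" using L R0 by (simp add: K_def add_nonneg_pos)
    define slab0 where "slab0 a M e = {c \<in> space ?L. (\<forall>b\<in>B. \<bar>c b\<bar> \<le> R) \<and>
      (\<forall>i<r. \<bar>a i + (\<Sum>b\<in>B. c b * M i b)\<bar> \<le> e)}" for a :: "nat \<Rightarrow> real" and M e
    obtain C where C: "C \<ge> 0" "\<forall>a M e. 0 < e \<longrightarrow> e \<le> 1 \<longrightarrow>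
      (\<forall>i<r. \<forall>k<r. real r * \<bar>(\<Sum>b\<in>B. \<gamma> k b * M i b) - (if i = k then 1 else 0)\<bar> \<le> 1/2) \<longrightarrow>
      slab0 a M e \<in> sets ?L \<and> emeasure ?L (slab0 a M e) \<le> ennreal (C * e ^ r)"
      unfolding slab0_def by (rule measure_slab_le[OF fB, of r \<gamma> R]) (simp add: that)
    \<comment> \<open>The first bound gives \<open>K * e \<le> 1\<close>, as
      \<open>measure_slab_le\<close> requires; the second brings the total measure of the slabs, at
      most \<open>C * K ^ r\<close> times \<open>card F * e ^ r\<close>, below
      \<open>\<delta>\<close>.\<close>
    define \<delta>' where "\<delta>' = min (1 / K) (\<delta> / (C * K ^ r + 1))"
    have CK: "C * K ^ r \<ge> 0" using C K by simp
    have "\<delta>' > 0" using \<delta> K CK by (simp add: \<delta>'_def add_nonneg_pos)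
    obtain F e where F: "finite F" "Z \<subseteq> \<Union>F" "0 < e" "e < \<delta>'"
       "\<forall>S\<in>F. \<forall>x\<in>S. \<forall>y\<in>S. dist x y \<le> e" "real (card F) * e ^ r < \<delta>'"
      using thinD[OF thin \<open>\<delta>' > 0\<close>] by (elim exE conjE) (rule that)
    have Ke: "0 < K * e" "K * e \<le> 1" using F K by (auto simp: \<delta>'_def field_simps)
    define slab where "slab z = slab0 (\<lambda>i. a i z) (\<lambda>i b. M i b z) (K * e)" for z
    have slab: "slab z \<in> sets ?L" "emeasure ?L (slab z) \<le> ennreal (C * (K * e) ^ r)" if "z \<in> Z" for z
      using C(2)[rule_format, OF Ke, of "\<lambda>i b. M i b z" "\<lambda>i. a i z"] near[OF that] by (simp_all add: slab_def)
    define F' where "F' = {S \<in> F. S \<inter> Z \<noteq> {}}"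
    \<comment> \<open>The representative has to lie in \<open>Z\<close>, since near-duality and the
      Lipschitz bounds are known only there.\<close>
    define p where "p S = (SOME z. z \<in> S \<inter> Z)" for S
    have p: "p S \<in> S" "p S \<in> Z" if "S \<in> F'" for S
      using that someI_ex[of "\<lambda>z. z \<in> S \<inter> Z"] by (auto simp: F'_def p_def)
    have F': "finite F'" "card F' \<le> card F" using F(1) by (auto simp: F'_def intro: card_mono)
    let ?E = "\<Union>S\<in>F'. slab (p S)"
    have E1: "?E \<in> sets ?L" by (intro sets.finite_UN slab(1) p(2) F'(1))
    have "emeasure ?L ?E \<le> (\<Sum>S\<in>F'. emeasure ?L (slab (p S)))"
      using slab(1)[OF p(2)] F'(1) by (intro emeasure_subadditive_finite image_subsetI)
    also have "\<dots> \<le> (\<Sum>S\<in>F'. ennreal (C * (K * e) ^ r))" by (intro sum_mono slab(2) p(2))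
    also have "\<dots> = ennreal (real (card F') * (C * (K * e) ^ r))"
    proof -
      have "C * (K * e) ^ r \<ge> 0" using C(1) Ke by simp
      then show ?thesis
        by (simp only: sum_constant ennreal_of_nat_eq_real_of_nat ennreal_mult' of_nat_0_le_iff)
    qed
    also have "\<dots> \<le> ennreal \<delta>"
    proof (rule ennreal_leI)
      have "real (card F') * (C * (K * e) ^ r) \<le> real (card F) * (C * (K * e) ^ r)"
        using F' C(1) Ke by (intro mult_right_mono) simp_all
      also have "\<dots> = (C * K ^ r) * (real (card F) * e ^ r)" by (simp add: power_mult_distrib)
      also have "\<dots> \<le> (C * K ^ r) * (\<delta> / (C * K ^ r + 1))"
        using F(6) CK unfolding \<delta>'_def by (intro mult_left_mono) linarith+
      also have "\<dots> = (C * K ^ r) / (C * K ^ r + 1) * \<delta>" by simp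
      also have "\<dots> \<le> 1 * \<delta>" 
      proof (rule mult_right_mono)
        have "q / (q + 1) \<le> 1" if "q \<ge> 0" for q :: real using that by simp
        then show "(C * K ^ r) / (C * K ^ r + 1) \<le> 1" using CK by blast
      qed (use \<delta> in linarith)
      also have "\<dots> = \<delta>" by simp
      finally show "real (card F') * (C * (K * e) ^ r) \<le> \<delta>" .
    qed
    finally have E2: "emeasure ?L ?E \<le> ennreal \<delta>" .
    have E3: "{c \<in> space ?L. \<not> ((\<forall>b\<in>B. \<bar>c b\<bar> \<le> R) \<longrightarrow> (\<forall>z\<in>Z. \<exists>i<r. a i z + (\<Sum>b\<in>B. c b * M i b z) \<noteq> 0))} \<subseteq> ?E"
    proof
      fix c assume c: "c \<in> {c \<in> space ?L. \<not> ((\<forall>b\<in>B. \<bar>c b\<bar> \<le> R) \<longrightarrow> (\<forall>z\<in>Z. \<exists>i<r. a i z + (\<Sum>b\<in>B. c b * M i b z) \<noteq> 0))}"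
      then obtain z where z: "z \<in> Z" "\<And>i. i < r \<Longrightarrow> a i z + (\<Sum>b\<in>B. c b * M i b z) = 0"
        and cR: "\<And>b. b \<in> B \<Longrightarrow> \<bar>c b\<bar> \<le> R" and csp: "c \<in> space ?L" by auto
      obtain S where S: "S \<in> F" "z \<in> S" using F(2) z(1) by auto
      then have S': "S \<in> F'" using z(1) by (auto simp: F'_def)
      let ?y = "p S"
      have d: "dist ?y z \<le> e" using F(5)[rule_format, OF S(1) p(1)[OF S'] S(2)] .
      have "\<bar>a i ?y + (\<Sum>b\<in>B. c b * M i b ?y)\<bar> \<le> K * e" if i: "i < r" for i
      proof -
        have 1: "\<bar>a i ?y - a i z\<bar> \<le> L * e"
          using order_trans[OF lipschitz_onD[OF lipa[OF i] p(2)[OF S'] z(1)] mult_left_mono[OF d L]]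
          by (simp add: dist_real_def)
        have 2: "\<bar>M i b ?y - M i b z\<bar> \<le> L * e" if "b \<in> B" for b
          using order_trans[OF lipschitz_onD[OF lipM[OF i that] p(2)[OF S'] z(1)] mult_left_mono[OF d L]]
          by (simp add: dist_real_def)
        have "\<bar>\<Sum>b\<in>B. c b * (M i b ?y - M i b z)\<bar> \<le> (\<Sum>b\<in>B. R * (L * e))"
          using 2 cR R0 by (intro order_trans[OF sum_abs] sum_mono) (auto simp: abs_mult intro!: mult_mono)
        then have 3: "\<bar>\<Sum>b\<in>B. c b * (M i b ?y - M i b z)\<bar> \<le> card B * (R * L) * e" by (simp add: mult.assoc)
        have "a i ?y + (\<Sum>b\<in>B. c b * M i b ?y) =
           (a i ?y - a i z) + (\<Sum>b\<in>B. c b * (M i b ?y - M i b z)) + (a i z + (\<Sum>b\<in>B. c b * M i b z))"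
          by (simp add: right_diff_distrib sum_subtractf)
        then have "\<bar>a i ?y + (\<Sum>b\<in>B. c b * M i b ?y)\<bar> \<le> L * e + card B * (R * L) * e"
          using 1 3 z(2)[OF i] by linarith
        also have "\<dots> = K * e - e" by (simp add: K_def algebra_simps)
        finally show ?thesis using F(3) by linarith
      qed
      then have "c \<in> slab ?y" using csp cR by (auto simp: slab_def slab0_def)
      then show "c \<in> ?E" using S' by auto
    qed
    show "\<exists>E\<in>sets ?L. {c \<in> space ?L. \<not> ((\<forall>b\<in>B. \<bar>c b\<bar> \<le> R) \<longrightarrow> (\<forall>z\<in>Z. \<exists>i<r. a i z + (\<Sum>b\<in>B. c b * M i b z) \<noteq> 0))} \<subseteq> E
        \<and> emeasure ?L E \<le> ennreal \<delta>" using E1 E2 E3 by blast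
  qed
  have "AE c in ?L. \<forall>n::nat. (\<forall>b\<in>B. \<bar>c b\<bar> \<le> real n) \<longrightarrow> (\<forall>z\<in>Z. \<exists>i<r. a i z + (\<Sum>b\<in>B. c b * M i b z) \<noteq> 0)"
    by (subst AE_all_countable, rule allI, rule R, rule of_nat_0_le_iff)
  then show ?thesis
  proof (rule eventually_mono)
    fix c assume *: "\<forall>n::nat. (\<forall>b\<in>B. \<bar>c b\<bar> \<le> real n) \<longrightarrow> (\<forall>z\<in>Z. \<exists>i<r. a i z + (\<Sum>b\<in>B. c b * M i b z) \<noteq> 0)"
    obtain n where n: "(\<Sum>b\<in>B. \<bar>c b\<bar>) \<le> real n" using real_arch_simple by blast
    have "\<forall>b\<in>B. \<bar>c b\<bar> \<le> real n"
      using order_trans[OF member_le_sum[OF _ abs_ge_zero fB] n] by blast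
    then show "\<forall>z\<in>Z. \<exists>i<r. a i z + (\<Sum>b\<in>B. c b * M i b z) \<noteq> 0"
      by (rule *[THEN spec, THEN mp])
  qed
qed

text \<open>\<open>U\<close> need be neither convex nor bounded, so a C1 map has Lipschitz bounds
  only near each point. Neighbourhoods are taken relative to \<open>X\<close> because the sets of
  pairs are not open.\<close>

definition locally_lipschitz_on :: "'a::metric_space set \<Rightarrow> ('a \<Rightarrow> 'b::metric_space) \<Rightarrow> bool" where
  "locally_lipschitz_on X f \<longleftrightarrow> (\<forall>x\<in>X. \<exists>W L. open W \<and> x \<in> W \<and> L-lipschitz_on (W \<inter> X) f)"

lemma locally_lipschitz_on_subset:
  "locally_lipschitz_on X f \<Longrightarrow> Y \<subseteq> X \<Longrightarrow> locally_lipschitz_on Y f"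
  unfolding locally_lipschitz_on_def by (meson Int_mono lipschitz_on_subset order_refl subsetD)

lemma locally_lipschitz_on_imp_continuous_on:
  assumes "locally_lipschitz_on X f" shows "continuous_on X f"
proof -
  have "continuous (at x within X) f" if x: "x \<in> X" for x
  proof -
    obtain W L where W: "open W" "x \<in> W" "L-lipschitz_on (W \<inter> X) f"
      using assms x unfolding locally_lipschitz_on_def by blast
    have "continuous (at x within (W \<inter> X)) f"
      using lipschitz_on_continuous_on[OF W(3)] W(2) x by (simp add: continuous_on_eq_continuous_within)
    moreover have "at x within (W \<inter> X) = at x within X"
      using W by (intro at_within_nhd[of _ W]) auto
    ultimately show ?thesis by simp
  qed
  then show ?thesis by (simp add: continuous_on_eq_continuous_within)
qed

lemma locally_lipschitz_on_finite_common:
  fixes f :: "'i \<Rightarrow> 'a::metric_space \<Rightarrow> 'b::metric_space"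
  assumes "finite I" "\<And>i. i \<in> I \<Longrightarrow> locally_lipschitz_on X (f i)" "x \<in> X"
  obtains W L where "open W" "x \<in> W" "L \<ge> 0" "\<And>i. i \<in> I \<Longrightarrow> L-lipschitz_on (W \<inter> X) (f i)"
proof -
  have "\<forall>i\<in>I. \<exists>W L. open W \<and> x \<in> W \<and> L-lipschitz_on (W \<inter> X) (f i)"
    using assms(2,3) unfolding locally_lipschitz_on_def by blast
  then obtain W L where WL: "\<And>i. i \<in> I \<Longrightarrow> open (W i) \<and> x \<in> W i \<and> (L i)-lipschitz_on (W i \<inter> X) (f i)"
    by metis
  let ?W = "\<Inter>i\<in>I. W i" and ?L = "\<Sum>i\<in>I. \<bar>L i\<bar>"
  show ?thesis
  proof (rule that[of ?W ?L])
    show "open ?W" using WL assms(1) by auto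
    show "x \<in> ?W" using WL by auto
    show "?L \<ge> 0" by (intro sum_nonneg) auto
    fix i assume i: "i \<in> I"
    have Li: "L i \<le> ?L" using member_le_sum[OF i abs_ge_zero assms(1), of L] by linarith
    show "?L-lipschitz_on (?W \<inter> X) (f i)"
      by (rule lipschitz_on_mono[OF WL[OF i, THEN conjunct2, THEN conjunct2] _ Li]) (use i in blast)
  qed
qed

text \<open>A family dual at \<open>z\<close> remains nearly dual close to \<open>z\<close> by
  continuity, so \<open>\<gamma>\<close> may depend on the point in any way. By second countability,
  countably many such patches cover \<open>Z\<close>, and countably many null sets are
  discarded.\<close>

lemma AE_affine_system_nonzero:
  fixes B :: "'b set" and Z :: "'z::{metric_space,second_countable_topology} set"
    and a :: "nat \<Rightarrow> 'z \<Rightarrow> real" and M :: "nat \<Rightarrow> 'b \<Rightarrow> 'z \<Rightarrow> real"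
  assumes fB: "finite B"
    and thin: "\<And>z. z \<in> Z \<Longrightarrow> \<exists>W. open W \<and> z \<in> W \<and> thin r (W \<inter> Z)"
    and lipa: "\<And>i. i < r \<Longrightarrow> locally_lipschitz_on Z (a i)"
    and lipM: "\<And>i b. i < r \<Longrightarrow> b \<in> B \<Longrightarrow> locally_lipschitz_on Z (M i b)"
    and dual: "\<And>z. z \<in> Z \<Longrightarrow> \<exists>\<gamma>. \<forall>i<r. \<forall>k<r. (\<Sum>b\<in>B. \<gamma> k b * M i b z) = (if i = k then 1 else 0)"
  shows "AE c in Pi\<^sub>M B (\<lambda>_. lborel). \<forall>z\<in>Z. \<exists>i<r. a i z + (\<Sum>b\<in>B. c b * M i b z) \<noteq> 0"
proof -
  let ?L = "Pi\<^sub>M B (\<lambda>_. lborel :: real measure)"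
  let ?P = "\<lambda>c z. \<exists>i<r. a i z + (\<Sum>b\<in>B. c b * M i b z) \<noteq> 0"
  have loc: "\<exists>W. open W \<and> z \<in> W \<and> (AE c in ?L. \<forall>z\<in>W \<inter> Z. ?P c z)" if z: "z \<in> Z" for z
  proof -
    obtain W0 where W0: "open W0" "z \<in> W0" "thin r (W0 \<inter> Z)" using thin z by blast
    obtain W1 L1 where W1: "open W1" "z \<in> W1" "L1 \<ge> 0" "\<And>i. i \<in> {..<r} \<Longrightarrow> L1-lipschitz_on (W1 \<inter> Z) (a i)"
      using locally_lipschitz_on_finite_common[of "{..<r}" Z a z] lipa z by auto
    obtain W2 L2 where W2: "open W2" "z \<in> W2" "L2 \<ge> 0"
       "\<And>p. p \<in> {..<r} \<times> B \<Longrightarrow> L2-lipschitz_on (W2 \<inter> Z) (case p of (i,b) \<Rightarrow> M i b)"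
    proof (rule locally_lipschitz_on_finite_common[of "{..<r} \<times> B" Z "\<lambda>(i,b). M i b" z])
      show "finite ({..<r} \<times> B)" using fB by simp
      show "locally_lipschitz_on Z (case p of (i, b) \<Rightarrow> M i b)" if "p \<in> {..<r} \<times> B" for p
        using that lipM by (cases p) auto
    qed (use z in blast)+
    obtain \<gamma> where \<gamma>: "\<And>i k. i < r \<Longrightarrow> k < r \<Longrightarrow> (\<Sum>b\<in>B. \<gamma> k b * M i b z) = (if i = k then 1 else 0)"
      using dual[OF z] by auto
    define Q where "Q i k W \<longleftrightarrow> open W \<and> z \<in> W \<and>
      (\<forall>y\<in>W \<inter> Z. real r * \<bar>(\<Sum>b\<in>B. \<gamma> k b * M i b y) - (if i = k then 1 else 0)\<bar> \<le> 1/2)" for i k W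
    have "\<exists>W. Q i k W" if ik: "i < r" "k < r" for i k
    proof -
      let ?f = "\<lambda>y. real r * \<bar>(\<Sum>b\<in>B. \<gamma> k b * M i b y) - (if i = k then 1 else 0)\<bar>"
      have co: "continuous_on Z ?f"
        using lipM[OF ik(1)] by (intro continuous_intros locally_lipschitz_on_imp_continuous_on) auto
      obtain W where W: "open W" "W \<inter> Z = ?f -` {..<1/2} \<inter> Z"
        using co[unfolded continuous_on_open_invariant] open_lessThan by blast
      have iff: "y \<in> W \<longleftrightarrow> ?f y < 1/2" if "y \<in> Z" for y using W(2) that by blast
      have "z \<in> W" by (simp add: iff[OF z] \<gamma>[OF ik])
      moreover have "?f y \<le> 1/2" if "y \<in> W \<inter> Z" for y using iff[of y] that by simp
      ultimately have "Q i k W" unfolding Q_def using W(1) by blast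
      then show ?thesis by blast
    qed
    then obtain V where V: "\<And>i k. i < r \<Longrightarrow> k < r \<Longrightarrow> Q i k (V i k)"
      by metis
    have VD: "open (V i k)" "z \<in> V i k" if "i < r" "k < r" for i k
      using V[OF that] by (auto simp: Q_def)
    define W where "W = W0 \<inter> W1 \<inter> W2 \<inter> (\<Inter>i\<in>{..<r}. \<Inter>k\<in>{..<r}. V i k)"
    have "open W" unfolding W_def using W0(1) W1(1) W2(1) VD(1) by (intro open_Int open_INT) auto
    moreover have "z \<in> W" using W0(2) W1(2) W2(2) VD(2) by (auto simp: W_def)
    moreover have "AE c in ?L. \<forall>z\<in>W \<inter> Z. ?P c z"
    proof (rule AE_affine_system_nonzero_aux[where L = "L1 + L2" and \<gamma> = \<gamma>])
      show "thin r (W \<inter> Z)" using W0(3) by (rule thin_subset) (auto simp: W_def)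
      show "(L1 + L2)-lipschitz_on (W \<inter> Z) (a i)" if "i < r" for i
        by (rule lipschitz_on_mono[OF W1(4)]) (use that W2(3) in \<open>auto simp: W_def\<close>)
      show "(L1 + L2)-lipschitz_on (W \<inter> Z) (M i b)" if "i < r" "b \<in> B" for i b
        by (rule lipschitz_on_mono[OF W2(4)[of "(i, b)", simplified]]) (use that W1(3) in \<open>auto simp: W_def\<close>)
      show "real r * \<bar>(\<Sum>b\<in>B. \<gamma> k b * M i b y) - (if i = k then 1 else 0)\<bar> \<le> 1/2"
        if "y \<in> W \<inter> Z" "i < r" "k < r" for i k y
      proof -
        have "y \<in> V i k \<inter> Z" using that by (auto simp: W_def)
        then show ?thesis using V[OF that(2,3)] unfolding Q_def by blast
      qed
      show "0 \<le> L1 + L2" using W1(3) W2(3) by simp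
    qed (rule fB)
    ultimately show ?thesis by blast
  qed
  define \<G> where "\<G> = {W. open W \<and> (AE c in ?L. \<forall>z\<in>W \<inter> Z. ?P c z)}"
  obtain \<H> where \<H>: "\<H> \<subseteq> \<G>" "countable \<H>" "\<Union>\<H> = \<Union>\<G>"
    using Lindelof[of \<G>] by (auto simp: \<G>_def)
  have "AE c in ?L. \<forall>W\<in>\<H>. \<forall>z\<in>W \<inter> Z. ?P c z"
    using \<H> by (subst AE_ball_countable) (auto simp: \<G>_def)
  then show ?thesis
  proof (rule eventually_mono)
    fix c assume c: "\<forall>W\<in>\<H>. \<forall>z\<in>W \<inter> Z. ?P c z"
    have "Z \<subseteq> \<Union>\<H>" using loc unfolding \<H>(3) by (auto simp: \<G>_def)
    then show "\<forall>z\<in>Z. ?P c z" using c by blast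
  qed
qed

section \<open>Box coverings\<close>

definition covered_by :: "real \<Rightarrow> real \<Rightarrow> 'a::metric_space set \<Rightarrow> bool" where
  "covered_by k D A \<longleftrightarrow> (\<exists>F. finite F \<and> A \<subseteq> \<Union>F \<and> (\<forall>S\<in>F. \<forall>x\<in>S. \<forall>y\<in>S. dist x y \<le> D) \<and>
     real (card F) \<le> k)"

text \<open>Only the upper estimate on the counts. A subset of a set with a box dimension need not
  have one, as the limit may fail to exist, whereas this estimate is inherited. The factor
  \<open>C\<close> absorbs the ratio between the diameter and the side of a box.\<close>

definition box_covered :: "real \<Rightarrow> 'a::metric_space set \<Rightarrow> bool" where
  "box_covered s A \<longleftrightarrow>
     (\<exists>C>0. \<exists>e0>0. \<forall>e. 0 < e \<and> e < e0 \<longrightarrow> covered_by (e powr (-s)) (C * e) A)"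

lemma covered_by_subset: "covered_by k D A \<Longrightarrow> B \<subseteq> A \<Longrightarrow> covered_by k D B"
  unfolding covered_by_def by (meson order_trans)

lemma box_covered_empty: "box_covered s {}"
proof -
  have "covered_by (e powr (-s)) (1 * e) ({} :: 'a set)" for e
    unfolding covered_by_def by (rule exI[of _ "{}"]) simp
  then show ?thesis unfolding box_covered_def by (meson zero_less_one)
qed

lemma box_covered_subset: "box_covered s A \<Longrightarrow> B \<subseteq> A \<Longrightarrow> box_covered s B"
  unfolding box_covered_def by (meson covered_by_subset)

text \<open>Guarantees that the \<open>LEAST\<close> in \<open>box_number\<close> is attained by an
  actual cover.\<close>

lemma ex_finite_box_cover:
  fixes A :: "(real ^ 'n) set"
  assumes "bounded A" "e > 0"
  shows "\<exists>F. finite F \<and> A \<subseteq> (\<Union>a\<in>F. cbox a (a + vec e))"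
proof -
  have "compact (closure A)" using assms(1) by simp
  then obtain k where k: "finite k" "closure A \<subseteq> (\<Union>x\<in>k. ball x (e/2))"
    using assms(2) unfolding compact_eq_totally_bounded by (meson half_gt_zero)
  have sub: "ball x (e/2) \<subseteq> cbox (x - vec (e/2)) (x - vec (e/2) + vec e)" for x :: "real ^ 'n"
  proof
    fix y assume "y \<in> ball x (e/2)"
    then have n: "norm (x - y) < e / 2" by (simp add: dist_norm)
    have ab: "\<bar>(x - y) $ i\<bar> < e / 2" for i
      using component_le_norm_cart[of "x - y" i] n by linarith
    have "(x - vec (e/2)) $ i \<le> y $ i \<and> y $ i \<le> (x - vec (e/2) + vec e) $ i" for i
      using ab[of i] unfolding vector_minus_component vector_add_component vec_component by linarith
    then show "y \<in> cbox (x - vec (e/2)) (x - vec (e/2) + vec e)" unfolding mem_box_cart by blast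
  qed
  have "closure A \<subseteq> (\<Union>a\<in>(\<lambda>x. x - vec (e/2)) ` k. cbox a (a + vec e))"
    by (rule order_trans[OF k(2)]) (simp only: UN_simps, intro UN_mono order_refl sub)
  then show ?thesis using k(1) closure_subset by (meson finite_imageI order_trans)
qed

lemma dist_cbox_vec_le:
  fixes a :: "real ^ 'n"
  assumes "x \<in> cbox a (a + vec e)" "y \<in> cbox a (a + vec e)"
  shows "dist x y \<le> real CARD('n) * e"
proof -
  have "\<bar>(x - y) $ i\<bar> \<le> e" for i
  proof -
    have "a $ i \<le> x $ i" "x $ i \<le> a $ i + e" "a $ i \<le> y $ i" "y $ i \<le> a $ i + e"
      using assms by (auto simp: mem_box_cart)
    then show ?thesis by (simp add: abs_le_iff)
  qed
  then have "(\<Sum>i\<in>UNIV. \<bar>(x - y) $ i\<bar>) \<le> (\<Sum>i\<in>(UNIV :: 'n set). e)" by (intro sum_mono)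
  then show ?thesis unfolding dist_norm using norm_le_l1_cart[of "x - y"] by simp
qed

lemma has_boxdim_imp_box_covered:
  fixes A :: "(real ^ 'n) set"
  assumes "has_boxdim A d" "d < s"
  shows "box_covered s A"
proof -
  have bd: "bounded A" and lim: "((\<lambda>e. ln (real (box_number e A)) / ln (1 / e)) \<longlongrightarrow> d) (at_right 0)"
    using assms(1) by (auto simp: has_boxdim_def)
  have "eventually (\<lambda>e. ln (real (box_number e A)) / ln (1 / e) < s) (at_right 0)"
    using order_tendstoD(2)[OF lim assms(2)] .
  then obtain b where b: "b > 0" "\<And>e. 0 < e \<Longrightarrow> e < b \<Longrightarrow> ln (real (box_number e A)) / ln (1 / e) < s"
    unfolding eventually_at_right_field by auto
  have cov: "covered_by (e powr (-s)) (real CARD('n) * e) A" if e: "0 < e" "e < min b 1" for e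
  proof -
    have "\<exists>k F. finite F \<and> card F = k \<and> A \<subseteq> (\<Union>a\<in>F. cbox a (a + vec e))"
      using ex_finite_box_cover[OF bd e(1)] by blast
    then have "\<exists>F. finite F \<and> card F = box_number e A \<and> A \<subseteq> (\<Union>a\<in>F. cbox a (a + vec e))"
      unfolding box_number_def by (rule LeastI_ex)
    then obtain F where F: "finite F" "card F = box_number e A" "A \<subseteq> (\<Union>a\<in>F. cbox a (a + vec e))"
      by blast
    let ?F = "(\<lambda>a. cbox a (a + vec e)) ` F"
    have "real (card ?F) \<le> real (box_number e A)" using card_image_le[OF F(1)] F(2) by (metis of_nat_le_iff)
    also have "\<dots> \<le> e powr (-s)"
    \<comment> \<open>An empty \<open>A\<close> has count 0, which \<open>exp (ln ...)\<close>
      cannot return.\<close>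
    proof (cases "box_number e A = 0")
      case False
      have l: "ln (1 / e) > 0" using e by simp
      have "ln (real (box_number e A)) < s * ln (1 / e)"
        using b(2)[of e] e l by (simp add: pos_divide_less_eq)
      then have "exp (ln (real (box_number e A))) \<le> exp (s * ln (1 / e))" by simp
      also have "\<dots> = e powr (-s)" using e by (simp add: powr_def ln_div)
      finally show ?thesis using False by simp
    qed simp
    finally have 1: "real (card ?F) \<le> e powr (-s)" .
    have 2: "\<forall>S\<in>?F. \<forall>x\<in>S. \<forall>y\<in>S. dist x y \<le> real CARD('n) * e"
      using dist_cbox_vec_le by blast
    show ?thesis unfolding covered_by_def by (rule exI[of _ ?F]) (use F 1 2 in simp)
  qed
  show ?thesis unfolding box_covered_def
  proof (intro exI conjI allI impI)
    show "real CARD('n) > 0" "min b 1 > 0" using b(1) by auto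
  qed (use cov in blast)
qed

text \<open>Serves to exclude \<open>m = 0\<close>: since \<open>d\<close> is nonnegative,
  \<open>2 * d < m\<close> forces at least one delay.\<close>

lemma has_boxdim_nonneg:
  fixes A :: "(real ^ 'n) set"
  assumes "has_boxdim A d" shows "d \<ge> 0"
proof (rule tendsto_lowerbound)
  show "((\<lambda>e. ln (real (box_number e A)) / ln (1 / e)) \<longlongrightarrow> d) (at_right 0)"
    using assms by (simp add: has_boxdim_def)
  have "0 \<le> ln (real (box_number e A)) / ln (1 / e)" if "0 < e" "e < 1" for e
    using that by (intro divide_nonneg_nonneg) (cases "box_number e A = 0", auto)
  then show "\<forall>\<^sub>F e in at_right 0. 0 \<le> ln (real (box_number e A)) / ln (1 / e)"
    unfolding eventually_at_right_field by (meson zero_less_one)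
qed simp

lemma box_covered_Times:
  assumes "box_covered s A" "box_covered t B"
  shows "box_covered (s + t) (A \<times> B)"
proof -
  obtain C e0 where C: "C > 0" "e0 > 0" and F: "\<And>e. 0 < e \<and> e < e0 \<Longrightarrow> covered_by (e powr (-s)) (C * e) A"
    using assms(1) unfolding box_covered_def by blast
  obtain D e1 where D: "D > 0" "e1 > 0" and G: "\<And>e. 0 < e \<and> e < e1 \<Longrightarrow> covered_by (e powr (-t)) (D * e) B"
    using assms(2) unfolding box_covered_def by blast
  have cov: "covered_by (e powr (-(s + t))) ((C + D) * e) (A \<times> B)" if e: "0 < e" "e < min e0 e1" for e
  proof -
    obtain F where F: "finite F" "A \<subseteq> \<Union>F" "\<forall>S\<in>F. \<forall>x\<in>S. \<forall>y\<in>S. dist x y \<le> C * e" "real (card F) \<le> e powr (-s)"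
      using F[of e] e unfolding covered_by_def by auto
    obtain G where G: "finite G" "B \<subseteq> \<Union>G" "\<forall>S\<in>G. \<forall>x\<in>S. \<forall>y\<in>S. dist x y \<le> D * e" "real (card G) \<le> e powr (-t)"
      using G[of e] e unfolding covered_by_def by auto
    let ?H = "(\<lambda>(S, S'). S \<times> S') ` (F \<times> G)"
    have "real (card ?H) \<le> real (card (F \<times> G))" using F(1) G(1) by (intro of_nat_mono card_image_le) auto
    also have "\<dots> = real (card F) * real (card G)" by (simp add: card_cartesian_product)
    also have "\<dots> \<le> e powr (-s) * e powr (-t)" using F(4) G(4) by (intro mult_mono) auto
    also have "\<dots> = e powr (-(s + t))" by (simp add: powr_add[symmetric])
    finally have 1: "real (card ?H) \<le> e powr (-(s + t))" .
    have 2: "dist x y \<le> (C + D) * e" if "S \<in> F" "S' \<in> G" "x \<in> S \<times> S'" "y \<in> S \<times> S'" for S S' x y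
    proof -
      have "dist x y \<le> dist (fst x) (fst y) + dist (snd x) (snd y)"
        unfolding dist_prod_def by (rule sqrt_sum_squares_le_sum) auto
      also have "\<dots> \<le> C * e + D * e" using F(3) G(3) that by (intro add_mono) auto
      finally show ?thesis by (simp add: distrib_right)
    qed
    have 3: "A \<times> B \<subseteq> \<Union>?H"
    proof
      fix z assume "z \<in> A \<times> B"
      then obtain S S' where "S \<in> F" "S' \<in> G" "fst z \<in> S" "snd z \<in> S'" using F(2) G(2) by fastforce
      then show "z \<in> \<Union>?H" by (intro UnionI[of "S \<times> S'"]) (auto simp: mem_Times_iff)
    qed
    have 4: "\<forall>S\<in>?H. \<forall>x\<in>S. \<forall>y\<in>S. dist x y \<le> (C + D) * e" using 2 by blast
    have 5: "finite ?H" using F(1) G(1) by simp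
    show ?thesis unfolding covered_by_def using 1 3 4 5 by blast
  qed
  show ?thesis unfolding box_covered_def
  proof (intro exI conjI allI impI)
    show "C + D > 0" "min e0 e1 > 0" using C D by auto
  qed (use cov in blast)
qed

text \<open>At scale \<open>C * e\<close> the relevant product is at most
  \<open>e powr (-s) * (C * e) ^ r = C ^ r * e powr (r - s)\<close>, which tends to 0.\<close>

lemma box_covered_imp_thin:
  assumes "box_covered s A" "s < real r"
  shows "thin r A"
  unfolding thin_def
proof (intro allI impI)
  fix \<delta> :: real assume \<delta>: "\<delta> > 0"
  obtain C e0 where C: "C > 0" "e0 > 0" and F: "\<And>e. 0 < e \<and> e < e0 \<Longrightarrow> covered_by (e powr (-s)) (C * e) A"
    using assms(1) unfolding box_covered_def by blast
  have l1: "((\<lambda>e. C ^ r * e powr (real r - s)) \<longlongrightarrow> C ^ r * 0) (at_right 0)"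
    by (intro tendsto_mult tendsto_const tendsto_zero_powrI[where b = "real r - s"])
       (use assms(2) in \<open>auto simp: eventually_at_right_field intro: exI[of _ 1]\<close>)
  have l2: "((\<lambda>e. C * e) \<longlongrightarrow> C * 0) (at_right 0)" by (intro tendsto_intros)
  have "eventually (\<lambda>e. C ^ r * e powr (real r - s) < \<delta> \<and> C * e < \<delta> \<and> 0 < e \<and> e < e0) (at_right 0)"
  proof (intro eventually_conj)
    show "\<forall>\<^sub>F e in at_right 0. C ^ r * e powr (real r - s) < \<delta>" using order_tendstoD(2)[OF l1] \<delta> by simp
    show "\<forall>\<^sub>F e in at_right 0. C * e < \<delta>" using order_tendstoD(2)[OF l2] \<delta> by simp
    show "\<forall>\<^sub>F e in at_right 0. (0::real) < e" by (rule eventually_at_right_less)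
    show "\<forall>\<^sub>F e in at_right 0. e < e0" unfolding eventually_at_right_field using C by blast
  qed
  then obtain e where e: "C ^ r * e powr (real r - s) < \<delta>" "C * e < \<delta>" "0 < e" "e < e0"
    using eventually_happens trivial_limit_at_right_real by blast
  obtain F where F: "finite F" "A \<subseteq> \<Union>F" "\<forall>S\<in>F. \<forall>x\<in>S. \<forall>y\<in>S. dist x y \<le> C * e" "real (card F) \<le> e powr (-s)"
    using F[of e] e unfolding covered_by_def by auto
  have "real (card F) * (C * e) ^ r \<le> e powr (-s) * (C * e) ^ r"
    using F(4) C e by (intro mult_right_mono) auto
  also have "\<dots> = C ^ r * (e powr (-s) * e powr (real r))"
    using e by (simp add: power_mult_distrib powr_realpow)
  also have "\<dots> = C ^ r * e powr (real r - s)" by (simp add: powr_add[symmetric])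
  finally have "real (card F) * (C * e) ^ r < \<delta>" using e(1) by linarith
  then show "\<exists>F e. finite F \<and> A \<subseteq> \<Union>F \<and> 0 < e \<and> e < \<delta> \<and>
     (\<forall>S\<in>F. \<forall>x\<in>S. \<forall>y\<in>S. dist x y \<le> e) \<and> real (card F) * e ^ r < \<delta>"
    using F(1-3) e(2,3) C(1) by (intro exI[of _ F] exI[of _ "C * e"]) simp
qed

section \<open>Observables dual to orbit differences\<close>

text \<open>Gaussian elimination. The new vector is annihilated by all earlier functionals, so
  subtracting multiples of it from the earlier vectors corrects their value under the new functional
  and disturbs nothing else.\<close>

lemma triangular_dual_system:
  fixes \<phi> :: "nat \<Rightarrow> 'v::real_vector \<Rightarrow> real"
  assumes W: "subspace W" and lin: "\<And>i. i < r \<Longrightarrow> linear (\<phi> i)"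
    and tri: "\<And>i. i < r \<Longrightarrow> \<exists>g\<in>W. \<phi> i g \<noteq> 0 \<and> (\<forall>k<i. \<phi> k g = 0)"
  shows "\<exists>g. \<forall>k<r. g k \<in> W \<and> (\<forall>i<r. \<phi> i (g k) = (if i = k then 1 else 0))"
  using lin tri
proof (induction r)
  case (Suc r)
  obtain g where g: "\<And>k. k < r \<Longrightarrow> g k \<in> W" "\<And>i k. k < r \<Longrightarrow> i < r \<Longrightarrow> \<phi> i (g k) = (if i = k then 1 else 0)"
    using Suc.IH Suc.prems less_SucI by metis
  obtain h0 where h0: "h0 \<in> W" "\<phi> r h0 \<noteq> 0" "\<forall>k<r. \<phi> k h0 = 0" using Suc.prems(2)[of r] by auto
  define h where "h = (1 / \<phi> r h0) *\<^sub>R h0"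
  have h: "h \<in> W" "\<phi> r h = 1" "\<And>k. k < r \<Longrightarrow> \<phi> k h = 0"
    using h0 W Suc.prems(1) by (auto simp: h_def linear_cmul subspace_scale)
  define g' where "g' k = (if k = r then h else g k - \<phi> r (g k) *\<^sub>R h)" for k
  have "g' k \<in> W \<and> (\<forall>i<Suc r. \<phi> i (g' k) = (if i = k then 1 else 0))" if k: "k < Suc r" for k
  proof (cases "k = r")
    case True
    then show ?thesis using h by (auto simp: g'_def less_Suc_eq)
  next
    case False
    then have k: "k < r" using k by simp
    have "g' k \<in> W" using False h(1) g(1)[OF k] W by (simp add: g'_def subspace_diff subspace_scale)
    moreover have "\<phi> i (g' k) = (if i = k then 1 else 0)" if i: "i < Suc r" for i
    proof -
      have "\<phi> i (g' k) = \<phi> i (g k) - \<phi> r (g k) * \<phi> i h"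
        using False Suc.prems(1)[OF i] by (simp add: g'_def linear_diff linear_cmul)
      then show ?thesis using False i h g(2)[OF k] by (cases "i = r") auto
    qed
    ultimately show ?thesis by blast
  qed
  then show ?case by blast
qed simp

definition separates_points :: "nat \<Rightarrow> 'a set \<Rightarrow> ('a \<Rightarrow> real) set \<Rightarrow> bool" where
  "separates_points N U W \<longleftrightarrow> (\<forall>P z. finite P \<longrightarrow> P \<subseteq> U \<longrightarrow> card P \<le> N \<longrightarrow> z \<in> P \<longrightarrow>
     (\<exists>g\<in>W. g z = 1 \<and> (\<forall>w\<in>P - {z}. g w = 0)))"

lemma separates_pointsD:
  assumes "separates_points N U W" "finite P" "P \<subseteq> U" "card P \<le> N" "z \<in> P"
  shows "\<exists>g\<in>W. g z = 1 \<and> (\<forall>w. w \<in> P \<longrightarrow> w \<noteq> z \<longrightarrow> g w = 0)"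
  using assms unfolding separates_points_def by (metis Diff_iff singletonD)

lemma linear_diff_eval: "linear (\<lambda>g :: 'a \<Rightarrow> real. g u - g v)"
  by (rule linearI) (auto simp: plus_fun_def scaleR_fun_def algebra_simps)

lemma funpow_image_subset: "T ` U \<subseteq> U \<Longrightarrow> x \<in> U \<Longrightarrow> (T ^^ i) x \<in> U"
  by (induction i) auto

text \<open>Injectivity cancels the common iterations, so two orbit segments can meet only if one
  starting point is an iterate of the other.\<close>

lemma funpow_eq_imp_periodic:
  assumes inj: "inj_on T U" and TU: "T ` U \<subseteq> U" and x: "x \<in> U" and "y \<in> U"
    and eq: "(T ^^ (i + k)) x = (T ^^ i) y"
  shows "(T ^^ k) x = y"
  using eq
proof (induction i)
  case (Suc i)
  then have "T ((T ^^ (i + k)) x) = T ((T ^^ i) y)" by simp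
  then have "(T ^^ (i + k)) x = (T ^^ i) y"
    using inj_onD[OF inj] funpow_image_subset[OF TU] x \<open>y \<in> U\<close> by blast
  then show ?case by (rule Suc.IH)
qed simp

text \<open>The point \<open>(T ^^ i) y\<close> occurs only once among the points involved, so a
  function that is 1 there and 0 at the others sees the \<open>i\<close>-th difference alone. The
  orbit of \<open>x\<close> may repeat itself, as it does when \<open>x\<close> has a period below
  \<open>q\<close>.\<close>

lemma dual_system_disjoint_orbits:
  assumes sep: "separates_points N U W" and N: "2 * q \<le> N" and W: "subspace W"
    and TU: "T ` U \<subseteq> U" and U: "x \<in> U" "y \<in> U"
    and inj: "inj_on (\<lambda>i. (T ^^ i) y) {..<q}"
    and disj: "\<And>i k. i < q \<Longrightarrow> k < q \<Longrightarrow> (T ^^ i) y \<noteq> (T ^^ k) x"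
  shows "\<exists>g. \<forall>k<q. g k \<in> W \<and> (\<forall>i<q. g k ((T ^^ i) x) - g k ((T ^^ i) y) = (if i = k then 1 else 0))"
proof (rule triangular_dual_system[OF W])
  let ?P = "(\<lambda>i. (T ^^ i) x) ` {..<q} \<union> (\<lambda>i. (T ^^ i) y) ` {..<q}"
  have "card ?P \<le> q + q"
    by (rule order_trans[OF card_Un_le]) (intro add_mono order_trans[OF card_image_le], auto)
  then have P: "finite ?P" "?P \<subseteq> U" "card ?P \<le> N"
    using N funpow_image_subset[OF TU] U by auto
  fix i assume i: "i < q"
  then obtain g where g: "g \<in> W" "g ((T ^^ i) y) = 1" "\<And>w. w \<in> ?P \<Longrightarrow> w \<noteq> (T ^^ i) y \<Longrightarrow> g w = 0"
    using separates_pointsD[OF sep P, of "(T ^^ i) y"] i by blast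
  have "g ((T ^^ k) x) = 0" if "k < q" for k using that disj[OF i that] by (intro g(3)) auto
  moreover have "g ((T ^^ k) y) = 0" if "k < i" for k
    using that i inj_onD[OF inj, of k i] by (intro g(3)) auto
  ultimately show "\<exists>g\<in>W. g ((T ^^ i) x) - g ((T ^^ i) y) \<noteq> 0 \<and> (\<forall>k<i. g ((T ^^ k) x) - g ((T ^^ k) y) = 0)"
    using g(1,2) i by (intro bexI[of _ g]) auto
qed (rule linear_diff_eval)

text \<open>For a point of exact period \<open>p\<close> the differences along one orbit may be linearly dependent,
  but the first half of them is independent; the pairs in question form a set of half the dimension.\<close>

lemma dual_system_same_orbit:
  assumes sep: "separates_points N U W" and N: "2 * p \<le> N" and W: "subspace W"
    and inj: "inj_on T U" and TU: "T ` U \<subseteq> U" and x: "x \<in> U"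
    and nper: "\<And>s. 0 < s \<Longrightarrow> s < p \<Longrightarrow> (T ^^ s) x \<noteq> x"
    and j: "0 < j" "j < p" and r: "2 * r \<le> p + 1"
  shows "\<exists>g. \<forall>k<r. g k \<in> W \<and>
    (\<forall>i<r. g k ((T ^^ i) x) - g k ((T ^^ i) ((T ^^ j) x)) = (if i = k then 1 else 0))"
proof (rule triangular_dual_system[OF W])
  \<comment> \<open>Indices up to \<open>i + j\<close> occur, and \<open>i\<close> and
    \<open>j\<close> are both below \<open>p\<close>. Repetitions in this list are harmless.\<close>
  let ?P = "(\<lambda>i. (T ^^ i) x) ` {..<2 * p}"
  have "card ?P \<le> 2 * p" using card_image_le[of "{..<2 * p}"] by simp
  then have P: "finite ?P" "?P \<subseteq> U" "card ?P \<le> N"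
    using N funpow_image_subset[OF TU x] by auto
  have dist: "(T ^^ a) x \<noteq> (T ^^ b) x" if "a < b" "b - a < p" for a b
  proof
    assume "(T ^^ a) x = (T ^^ b) x"
    then have "(T ^^ (b - a)) x = x"
      using that by (intro funpow_eq_imp_periodic[OF inj TU x x, of a]) simp
    then show False using nper[of "b - a"] that by auto
  qed
  fix i assume i: "i < r"
  have "\<exists>g\<in>W. g ((T ^^ i) x) - g ((T ^^ (i + j)) x) \<noteq> 0 \<and> (\<forall>k<i. g ((T ^^ k) x) - g ((T ^^ (k + j)) x) = 0)"
  \<comment> \<open>For small \<open>j\<close>, the index \<open>i + j\<close> stays below
    \<open>p\<close>, so \<open>(T ^^ (i + j)) x\<close> is a point that none of the earlier indices
    has reached. For large \<open>j\<close> it may have wrapped around the period; but then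
    \<open>2 * r \<le> p + 1\<close> gives \<open>j \<ge> r > i\<close>, so the shifted indices
    \<open>k + j\<close> with \<open>k \<le> i\<close> lie strictly between \<open>i\<close> and
    \<open>i + p\<close>, and \<open>(T ^^ i) x\<close> is the new point instead.\<close>
  proof (cases "j + r \<le> p")
    case True
    have "(T ^^ (i + j)) x \<in> ?P" using i j r by auto
    then obtain g where g: "g \<in> W" "g ((T ^^ (i + j)) x) = 1" "\<And>w. w \<in> ?P \<Longrightarrow> w \<noteq> (T ^^ (i + j)) x \<Longrightarrow> g w = 0"
      using separates_pointsD[OF sep P] by blast
    have "g ((T ^^ k) x) = 0" if "k < i + j" for k
      using that i j r True dist[of k "i + j"] by (intro g(3)) auto
    then show ?thesis using g(1,2) j by (intro bexI[of _ g]) auto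
  next
    case False
    have "(T ^^ i) x \<in> ?P" using i j r by auto
    then obtain g where g: "g \<in> W" "g ((T ^^ i) x) = 1" "\<And>w. w \<in> ?P \<Longrightarrow> w \<noteq> (T ^^ i) x \<Longrightarrow> g w = 0"
      using separates_pointsD[OF sep P] by blast
    have 1: "g ((T ^^ k) x) = 0" if "k < i" for k
      using that i r dist[of k i] j by (intro g(3)) auto
    have 2: "g ((T ^^ (k + j)) x) = 0" if "k \<le> i" for k
    proof (rule g(3))
      show "(T ^^ (k + j)) x \<in> ?P" using that i j r by auto
      have "i < k + j" "k + j - i < p" using that i j r False by auto
      then show "(T ^^ (k + j)) x \<noteq> (T ^^ i) x" using dist[of i "k + j"] by simp
    qed
    show ?thesis using 1 2 g(1,2) by (intro bexI[of _ g]) auto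
  qed
  then show "\<exists>g\<in>W. g ((T ^^ i) x) - g ((T ^^ i) ((T ^^ j) x)) \<noteq> 0 \<and>
      (\<forall>k<i. g ((T ^^ k) x) - g ((T ^^ k) ((T ^^ j) x)) = 0)"
    by (simp add: funpow_add)
qed (rule linear_diff_eval)

section \<open>Maps of class C1 and the probe space\<close>

lemma locally_lipschitz_on_compose:
  assumes g: "locally_lipschitz_on U g" and f: "locally_lipschitz_on V f" and gU: "g ` U \<subseteq> V"
  shows "locally_lipschitz_on U (\<lambda>x. f (g x))"
  unfolding locally_lipschitz_on_def
proof
  fix x assume x: "x \<in> U"
  obtain W L where W: "open W" "x \<in> W" "L-lipschitz_on (W \<inter> U) g"
    using g x unfolding locally_lipschitz_on_def by blast
  have gx: "g x \<in> V" using gU x by auto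
  obtain W' L' where W': "open W'" "g x \<in> W'" "L'-lipschitz_on (W' \<inter> V) f"
    using f gx unfolding locally_lipschitz_on_def by blast
  obtain A where A: "open A" "A \<inter> U = g -` W' \<inter> U"
    using locally_lipschitz_on_imp_continuous_on[OF g, unfolded continuous_on_open_invariant] W'(1) by blast
  have "(L' * L)-lipschitz_on (W \<inter> A \<inter> U) (f \<circ> g)"
  proof (rule lipschitz_on_compose)
    show "L-lipschitz_on (W \<inter> A \<inter> U) g" by (rule lipschitz_on_subset[OF W(3)]) auto
    show "L'-lipschitz_on (g ` (W \<inter> A \<inter> U)) f"
      by (rule lipschitz_on_subset[OF W'(3)]) (use A(2) gU in blast)
  qed
  then have "(L' * L)-lipschitz_on (W \<inter> A \<inter> U) (\<lambda>x. f (g x))" by (simp add: o_def)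
  moreover have "x \<in> A" using A(2) W'(2) x by blast
  ultimately show "\<exists>W L. open W \<and> x \<in> W \<and> L-lipschitz_on (W \<inter> U) (\<lambda>x. f (g x))"
    using W(1,2) A(1) by (intro exI[of _ "W \<inter> A"] exI[of _ "L' * L"]) auto
qed

lemma locally_lipschitz_on_funpow:
  assumes "locally_lipschitz_on U T" "T ` U \<subseteq> U"
  shows "locally_lipschitz_on U (T ^^ i)"
proof (induction i)
  case 0
  have "1-lipschitz_on (UNIV \<inter> U) (\<lambda>x. x)" by (rule lipschitz_intros)
  then show ?case unfolding locally_lipschitz_on_def
    by (intro ballI exI[of _ UNIV] exI[of _ 1]) (simp add: id_def)
next
  case (Suc i)
  have "locally_lipschitz_on U (\<lambda>x. T ((T ^^ i) x))"
    using funpow_image_subset[OF assms(2)] by (intro locally_lipschitz_on_compose[OF Suc assms(1)]) auto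
  then show ?case by (simp add: o_def)
qed

lemma locally_lipschitz_on_pair_diff:
  fixes h :: "'a::metric_space \<Rightarrow> real"
  assumes "locally_lipschitz_on U h"
  shows "locally_lipschitz_on (U \<times> U) (\<lambda>z. h (fst z) - h (snd z))"
  unfolding locally_lipschitz_on_def
proof
  fix z assume "z \<in> U \<times> U"
  then have z: "fst z \<in> U" "snd z \<in> U" by auto
  obtain W L where W: "open W" "fst z \<in> W" "L-lipschitz_on (W \<inter> U) h"
    using assms z(1) unfolding locally_lipschitz_on_def by blast
  obtain W' L' where W': "open W'" "snd z \<in> W'" "L'-lipschitz_on (W' \<inter> U) h"
    using assms z(2) unfolding locally_lipschitz_on_def by blast
  have "(L + L')-lipschitz_on ((W \<times> W') \<inter> (U \<times> U)) (\<lambda>z. h (fst z) - h (snd z))"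
  proof (rule lipschitz_onI)
    show "0 \<le> L + L'" using lipschitz_on_nonneg[OF W(3)] lipschitz_on_nonneg[OF W'(3)] by simp
    fix u v assume u: "u \<in> (W \<times> W') \<inter> (U \<times> U)" and v: "v \<in> (W \<times> W') \<inter> (U \<times> U)"
    have "\<bar>h (fst u) - h (fst v)\<bar> \<le> L * dist (fst u) (fst v)"
      using lipschitz_onD[OF W(3), of "fst u" "fst v"] u v by (auto simp: dist_real_def)
    also have "\<dots> \<le> L * dist u v" using lipschitz_on_nonneg[OF W(3)] by (intro mult_left_mono dist_fst_le)
    finally have 1: "\<bar>h (fst u) - h (fst v)\<bar> \<le> L * dist u v" .
    have "\<bar>h (snd u) - h (snd v)\<bar> \<le> L' * dist (snd u) (snd v)"
      using lipschitz_onD[OF W'(3), of "snd u" "snd v"] u v by (auto simp: dist_real_def)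
    also have "\<dots> \<le> L' * dist u v" using lipschitz_on_nonneg[OF W'(3)] by (intro mult_left_mono dist_snd_le)
    finally have 2: "\<bar>h (snd u) - h (snd v)\<bar> \<le> L' * dist u v" .
    show "dist (h (fst u) - h (snd u)) (h (fst v) - h (snd v)) \<le> (L + L') * dist u v"
      using 1 2 unfolding dist_real_def distrib_right by linarith
  qed
  then show "\<exists>W L. open W \<and> z \<in> W \<and> L-lipschitz_on (W \<inter> (U \<times> U)) (\<lambda>z. h (fst z) - h (snd z))"
    using W W' by (intro exI[of _ "W \<times> W'"] exI[of _ "L + L'"]) (auto simp: mem_Times_iff intro: open_Times)
qed

text \<open>On a small ball, which is convex, the derivative stays within 1 of its value at the
  centre, and the mean value inequality applies.\<close>

lemma C1_on_imp_locally_lipschitz_on: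
  fixes f :: "'a::real_normed_vector \<Rightarrow> 'b::real_normed_vector"
  assumes "open U" "C1_on U f"
  shows "locally_lipschitz_on U f"
  unfolding locally_lipschitz_on_def
proof
  fix x assume x: "x \<in> U"
  obtain f' :: "'a \<Rightarrow> 'a \<Rightarrow>\<^sub>L 'b" where f': "\<And>y. y \<in> U \<Longrightarrow> (f has_derivative blinfun_apply (f' y)) (at y)" "continuous_on U f'"
    using assms(2) unfolding C1_on_def by blast
  obtain d where d: "d > 0" "\<And>y. y \<in> U \<Longrightarrow> dist y x < d \<Longrightarrow> dist (f' y) (f' x) < 1"
    using f'(2) x unfolding continuous_on_iff by (metis zero_less_one)
  obtain e where e: "e > 0" "ball x e \<subseteq> U" using assms(1) x open_contains_ball by blast
  let ?B = "ball x (min d e)" and ?L = "norm (f' x) + 1"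
  have BU: "?B \<subseteq> U" using e by auto
  have n: "norm (f' y) \<le> ?L" if "y \<in> ?B" for y
  proof -
    have "dist (f' y) (f' x) < 1" using d(2)[of y] that BU by (auto simp: dist_commute)
    then show ?thesis using norm_triangle_sub[of "f' y" "f' x"] by (simp add: dist_norm)
  qed
  have "?L-lipschitz_on ?B f"
  proof (rule lipschitz_onI)
    fix y z assume yz: "y \<in> ?B" "z \<in> ?B"
    have "norm (f y - f z) \<le> ?L * norm (y - z)"
    proof (rule differentiable_bound[of ?B f "\<lambda>y. blinfun_apply (f' y)"])
      show "(f has_derivative blinfun_apply (f' y)) (at y within ?B)" if "y \<in> ?B" for y
        using f'(1)[of y] that BU has_derivative_at_withinI by blast
      show "onorm (blinfun_apply (f' y)) \<le> ?L" if "y \<in> ?B" for y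
        using n[OF that] by (simp add: norm_blinfun.rep_eq)
    qed (use yz in auto)
    then show "dist (f y) (f z) \<le> ?L * dist y z" by (simp add: dist_norm)
  qed simp
  then have "?L-lipschitz_on (?B \<inter> U) f" by (rule lipschitz_on_subset) auto
  then show "\<exists>W L. open W \<and> x \<in> W \<and> L-lipschitz_on (W \<inter> U) f"
    using d(1) e(1) by (intro exI[of _ ?B] exI[of _ ?L]) auto
qed

section \<open>The vector space of C1 functions and its polynomials\<close>

lemma sum_scaleR_fun_apply: "(\<Sum>b\<in>B. c b *\<^sub>R b) x = (\<Sum>b\<in>B. c b * b x)"
  for c :: "('a \<Rightarrow> real) \<Rightarrow> real"
  by (induction B rule: infinite_finite_induct) (auto simp: plus_fun_def zero_fun_def scaleR_fun_def)

text \<open>Derivatives are taken in the full space; openness of \<open>U\<close> hides the values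
  outside it, so that extension by zero does no harm.\<close>

lemma C1_on_cong_open:
  assumes "open U" "C1_on U f" "\<And>x. x \<in> U \<Longrightarrow> f x = g x"
  shows "C1_on U g"
proof -
  obtain f' where f': "\<And>x. x \<in> U \<Longrightarrow> (f has_derivative blinfun_apply (f' x)) (at x)" "continuous_on U f'"
    using assms(2) unfolding C1_on_def by blast
  have "(g has_derivative blinfun_apply (f' x)) (at x)" if x: "x \<in> U" for x
    using has_derivative_transform_within_open[OF f'(1)[OF x] assms(1) x assms(3)] .
  then show ?thesis unfolding C1_on_def using f'(2) by blast
qed

lemma C1_on_const: "C1_on U (\<lambda>x. c)"
  unfolding C1_on_def by (rule exI[of _ "\<lambda>x. 0"]) (auto simp: zero_blinfun.rep_eq)

lemma C1_on_vec_nth: "C1_on U (\<lambda>x :: real ^ 'n. x $ i)"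
  unfolding C1_on_def
proof (rule exI[of _ "\<lambda>x. Blinfun (\<lambda>x. x $ i)"], intro conjI ballI)
  have bl: "bounded_linear (\<lambda>x :: real ^ 'n. x $ i)" by (rule bounded_linear_vec_nth)
  show "((\<lambda>x. x $ i) has_derivative blinfun_apply (Blinfun (\<lambda>x. x $ i))) (at x)" for x :: "real ^ 'n"
    by (simp add: bounded_linear_Blinfun_apply[OF bl] bounded_linear_imp_has_derivative[OF bl])
qed simp

lemma C1_on_add:
  assumes "C1_on U f" "C1_on U g"
  shows "C1_on U (\<lambda>x. f x + g x)"
proof -
  obtain f' where f': "\<And>x. x \<in> U \<Longrightarrow> (f has_derivative blinfun_apply (f' x)) (at x)" "continuous_on U f'"
    using assms(1) unfolding C1_on_def by blast
  obtain g' where g': "\<And>x. x \<in> U \<Longrightarrow> (g has_derivative blinfun_apply (g' x)) (at x)" "continuous_on U g'"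
    using assms(2) unfolding C1_on_def by blast
  have "((\<lambda>x. f x + g x) has_derivative blinfun_apply (f' x + g' x)) (at x)" if x: "x \<in> U" for x
    using has_derivative_add[OF f'(1)[OF x] g'(1)[OF x]] by (simp add: blinfun.add_left[abs_def] plus_blinfun.rep_eq)
  moreover have "continuous_on U (\<lambda>x. f' x + g' x)" using f'(2) g'(2) by (intro continuous_intros)
  ultimately show ?thesis unfolding C1_on_def by (intro exI[of _ "\<lambda>x. f' x + g' x"]) blast
qed

lemma C1_on_mult:
  fixes f g :: "'a::real_normed_vector \<Rightarrow> real"
  assumes "C1_on U f" "C1_on U g"
  shows "C1_on U (\<lambda>x. f x * g x)"
proof -
  obtain f' where f': "\<And>x. x \<in> U \<Longrightarrow> (f has_derivative blinfun_apply (f' x)) (at x)" "continuous_on U f'"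
    using assms(1) unfolding C1_on_def by blast
  obtain g' where g': "\<And>x. x \<in> U \<Longrightarrow> (g has_derivative blinfun_apply (g' x)) (at x)" "continuous_on U g'"
    using assms(2) unfolding C1_on_def by blast
  have "((\<lambda>x. f x * g x) has_derivative blinfun_apply (f x *\<^sub>R g' x + g x *\<^sub>R f' x)) (at x)" if x: "x \<in> U" for x
  proof -
    have "blinfun_apply (f x *\<^sub>R g' x + g x *\<^sub>R f' x) = (\<lambda>h. f x * g' x h + f' x h * g x)"
      by (rule ext) (simp add: blinfun.add_left blinfun.scaleR_left)
    then show ?thesis using has_derivative_mult[OF f'(1)[OF x] g'(1)[OF x]] by simp
  qed
  moreover have "continuous_on U f" "continuous_on U g"
    using f'(1) g'(1) by (auto intro!: continuous_at_imp_continuous_on has_derivative_continuous)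
  then have "continuous_on U (\<lambda>x. f x *\<^sub>R g' x + g x *\<^sub>R f' x)" using f'(2) g'(2) by (intro continuous_intros)
  ultimately show ?thesis unfolding C1_on_def by (intro exI[of _ "\<lambda>x. f x *\<^sub>R g' x + g x *\<^sub>R f' x"]) blast
qed

lemma subspace_C1_space:
  assumes "open U" shows "subspace (C1_space U)"
proof (rule subspaceI)
  show "0 \<in> C1_space U"
    using C1_on_const[of U 0] by (simp add: C1_space_def zero_fun_def)
  show "f + g \<in> C1_space U" if "f \<in> C1_space U" "g \<in> C1_space U" for f g
    using that by (auto simp: C1_space_def plus_fun_def intro: C1_on_add)
  show "c *\<^sub>R f \<in> C1_space U" if "f \<in> C1_space U" for c f
    using that by (auto simp: C1_space_def scaleR_fun_def intro: C1_on_mult C1_on_const)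
qed

text \<open>These functions span the polynomials of degree at most \<open>k\<close>, extended by zero outside \<open>U\<close>.\<close>

primrec monomials_on :: "(real ^ 'n) set \<Rightarrow> nat \<Rightarrow> (real ^ 'n \<Rightarrow> real) set" where
  "monomials_on U 0 = {indicator U}"
| "monomials_on U (Suc k) = monomials_on U k \<union> (\<Union>i. (\<lambda>g x. x $ i * g x) ` monomials_on U k)"

lemma finite_monomials_on: "finite (monomials_on U k)"
  by (induction k) auto

lemma monomials_on_subset_C1_space:
  fixes U :: "(real ^ 'n) set"
  assumes "open U" shows "monomials_on U k \<subseteq> C1_space U"
proof (induction k)
  case 0
  have "C1_on U (indicator U :: real ^ 'n \<Rightarrow> real)"
    by (rule C1_on_cong_open[OF assms C1_on_const[of U 1]]) simp
  then show ?case by (simp add: C1_space_def)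
next
  case (Suc k)
  then show ?case by (auto simp: C1_space_def intro: C1_on_mult C1_on_vec_nth)
qed

lemma span_monomials_on_mult:
  fixes U :: "(real ^ 'n) set"
  assumes "f \<in> span (monomials_on U k)"
  shows "(\<lambda>x. (x $ i - c) * f x) \<in> span (monomials_on U (Suc k))"
proof -
  have lin: "linear (\<lambda>(f :: real ^ 'n \<Rightarrow> real) x. x $ i * f x)"
    by (rule linearI) (auto simp: plus_fun_def scaleR_fun_def algebra_simps)
  have "(\<lambda>x. x $ i * f x) \<in> (\<lambda>f x. x $ i * f x) ` span (monomials_on U k)" using assms by blast
  also have "\<dots> = span ((\<lambda>f x. x $ i * f x) ` monomials_on U k)" by (rule linear_span_image[OF lin, symmetric])
  also have "\<dots> \<subseteq> span (monomials_on U (Suc k))" by (rule span_mono) auto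
  finally have 1: "(\<lambda>x. x $ i * f x) \<in> span (monomials_on U (Suc k))" .
  have 2: "f \<in> span (monomials_on U (Suc k))" using assms span_mono[of "monomials_on U k" "monomials_on U (Suc k)"] by auto
  have "(\<lambda>x. (x $ i - c) * f x) = (\<lambda>x. x $ i * f x) - c *\<^sub>R f"
    by (rule ext) (simp add: fun_diff_def scaleR_fun_def left_diff_distrib)
  then show ?thesis using span_diff[OF 1 span_scale[OF 2]] by simp
qed

text \<open>One linear factor per point of \<open>Q\<close>: a point \<open>w\<close> differs from
  \<open>z\<close> in some coordinate \<open>i\<close>, and
  \<open>(x $ i - w $ i) / (z $ i - w $ i)\<close> vanishes at \<open>w\<close> and is 1 at
  \<open>z\<close>.\<close>

lemma ex_lagrange_polynomial:
  fixes z :: "real ^ 'n"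
  assumes "z \<in> U" "finite Q" "z \<notin> Q" "card Q \<le> k"
  shows "\<exists>f\<in>span (monomials_on U k). f z = 1 \<and> (\<forall>w\<in>Q. f w = 0)"
  using assms(2-4)
proof (induction Q arbitrary: k rule: finite_induct)
  case empty
  have "indicator U \<in> monomials_on U k" by (induction k) auto
  then show ?case using assms(1) by (intro bexI[of _ "indicator U"] span_base) auto
next
  case (insert w Q)
  then obtain l where l: "k = Suc l" "card Q \<le> l" by (cases k) auto
  then obtain f where f: "f \<in> span (monomials_on U l)" "f z = 1" "\<forall>w\<in>Q. f w = 0"
    using insert.IH[of l] insert.prems by auto
  have "w \<noteq> z" using insert.prems by auto
  then obtain i where i: "w $ i \<noteq> z $ i" by (auto simp: vec_eq_iff)
  let ?g = "(1 / (z $ i - w $ i)) *\<^sub>R (\<lambda>x. (x $ i - w $ i) * f x)"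
  have "?g \<in> span (monomials_on U k)" unfolding l(1) by (rule span_scale[OF span_monomials_on_mult[OF f(1)]])
  moreover have "?g z = 1 \<and> (\<forall>w\<in>insert w Q. ?g w = 0)" using f(2,3) i by (auto simp: scaleR_fun_def)
  ultimately show ?case by blast
qed

lemma separates_points_span_monomials_on: "separates_points N U (span (monomials_on U N))"
  unfolding separates_points_def
proof (intro allI impI)
  fix P and z :: "real ^ 'a" assume P: "finite P" "P \<subseteq> U" "card P \<le> N" "z \<in> P"
  have "card (P - {z}) \<le> N" using P(1,3) by (metis card_Diff1_le order_trans)
  then show "\<exists>g\<in>span (monomials_on U N). g z = 1 \<and> (\<forall>w\<in>P - {z}. g w = 0)"
    using P by (intro ex_lagrange_polynomial) auto
qed

section \<open>Injectivity of delay maps\<close>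

text \<open>The differences of \<open>v\<close> form the constant part of the affine system and
  those of the \<open>b\<close> its matrix. The coordinates of \<open>g k\<close> with respect to
  \<open>B\<close> are then the dual vectors that \<open>AE_affine_system_nonzero\<close> asks
  for.\<close>

lemma AE_observable_separates_pairs:
  fixes U :: "'a::{metric_space,second_countable_topology} set" and v :: "'a \<Rightarrow> real"
  assumes fB: "finite B" and Blip: "\<And>b. b \<in> B \<Longrightarrow> locally_lipschitz_on U b"
    and vlip: "locally_lipschitz_on U v"
    and Tlip: "locally_lipschitz_on U T" and TU: "T ` U \<subseteq> U" and ZU: "Z \<subseteq> U \<times> U"
    and thin: "\<And>z. z \<in> Z \<Longrightarrow> \<exists>W. open W \<and> z \<in> W \<and> thin r (W \<inter> Z)"
    and dual: "\<And>z. z \<in> Z \<Longrightarrow> \<exists>g. \<forall>k<r. g k \<in> span B \<and>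
      (\<forall>i<r. g k ((T ^^ i) (fst z)) - g k ((T ^^ i) (snd z)) = (if i = k then 1 else 0))"
  shows "AE c in Pi\<^sub>M B (\<lambda>_. lborel). \<forall>z\<in>Z. \<exists>i<r.
    (v + (\<Sum>b\<in>B. c b *\<^sub>R b)) ((T ^^ i) (fst z)) \<noteq> (v + (\<Sum>b\<in>B. c b *\<^sub>R b)) ((T ^^ i) (snd z))"
proof -
  have lip: "locally_lipschitz_on Z (\<lambda>z. h ((T ^^ i) (fst z)) - h ((T ^^ i) (snd z)))"
    if "locally_lipschitz_on U h" for h :: "'a \<Rightarrow> real" and i
  proof -
    have "locally_lipschitz_on U (\<lambda>x. h ((T ^^ i) x))"
      by (rule locally_lipschitz_on_compose[OF locally_lipschitz_on_funpow[OF Tlip TU] that])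
        (use funpow_image_subset[OF TU] in blast)
    then show ?thesis by (rule locally_lipschitz_on_subset[OF locally_lipschitz_on_pair_diff ZU])
  qed
  have "AE c in Pi\<^sub>M B (\<lambda>_. lborel). \<forall>z\<in>Z. \<exists>i<r.
     (v ((T ^^ i) (fst z)) - v ((T ^^ i) (snd z))) +
     (\<Sum>b\<in>B. c b * (b ((T ^^ i) (fst z)) - b ((T ^^ i) (snd z)))) \<noteq> 0"
  proof (rule AE_affine_system_nonzero[OF fB thin])
    fix z assume "z \<in> Z"
    from dual[OF this] obtain g where "\<forall>k<r. g k \<in> span B \<and>
      (\<forall>i<r. g k ((T ^^ i) (fst z)) - g k ((T ^^ i) (snd z)) = (if i = k then 1 else 0))" ..
    then have g: "\<And>k. k < r \<Longrightarrow> g k \<in> span B"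
      "\<And>i k. k < r \<Longrightarrow> i < r \<Longrightarrow> g k ((T ^^ i) (fst z)) - g k ((T ^^ i) (snd z)) = (if i = k then 1 else 0)"
      by simp_all
    have "\<exists>\<gamma>. g k = (\<Sum>b\<in>B. \<gamma> b *\<^sub>R b)" if "k < r" for k
      using g(1)[OF that] unfolding span_finite[OF fB] by blast
    then have "\<forall>k\<in>{..<r}. \<exists>\<gamma>. g k = (\<Sum>b\<in>B. \<gamma> b *\<^sub>R b)" by simp
    then obtain \<gamma> where "\<forall>k\<in>{..<r}. g k = (\<Sum>b\<in>B. \<gamma> k b *\<^sub>R b)" by (rule bchoice[THEN exE])
    then have \<gamma>: "\<And>k. k < r \<Longrightarrow> g k = (\<Sum>b\<in>B. \<gamma> k b *\<^sub>R b)" by simp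
    have "(\<Sum>b\<in>B. \<gamma> k b * (b ((T ^^ i) (fst z)) - b ((T ^^ i) (snd z)))) = (if i = k then 1 else 0)"
      if "i < r" "k < r" for i k
    proof -
      have "(\<Sum>b\<in>B. \<gamma> k b * (b ((T ^^ i) (fst z)) - b ((T ^^ i) (snd z)))) =
         g k ((T ^^ i) (fst z)) - g k ((T ^^ i) (snd z))"
        by (simp add: \<gamma>[OF that(2)] sum_scaleR_fun_apply right_diff_distrib sum_subtractf)
      then show ?thesis using g(2)[OF that(2,1)] by simp
    qed
    then show "\<exists>\<gamma>. \<forall>i<r. \<forall>k<r. (\<Sum>b\<in>B. \<gamma> k b * (b ((T ^^ i) (fst z)) - b ((T ^^ i) (snd z)))) = (if i = k then 1 else 0)"
      by blast
  qed (use lip vlip Blip in blast)+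
  then show ?thesis
  proof (rule eventually_mono)
    fix c :: "('a \<Rightarrow> real) \<Rightarrow> real"
    have eq: "(v ((T ^^ i) (fst z)) - v ((T ^^ i) (snd z))) +
     (\<Sum>b\<in>B. c b * (b ((T ^^ i) (fst z)) - b ((T ^^ i) (snd z)))) =
      (v + (\<Sum>b\<in>B. c b *\<^sub>R b)) ((T ^^ i) (fst z)) - (v + (\<Sum>b\<in>B. c b *\<^sub>R b)) ((T ^^ i) (snd z))" for i z
      by (simp add: sum_scaleR_fun_apply right_diff_distrib sum_subtractf)
    assume "\<forall>z\<in>Z. \<exists>i<r. (v ((T ^^ i) (fst z)) - v ((T ^^ i) (snd z))) +
     (\<Sum>b\<in>B. c b * (b ((T ^^ i) (fst z)) - b ((T ^^ i) (snd z)))) \<noteq> 0"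
    then show "\<forall>z\<in>Z. \<exists>i<r. (v + (\<Sum>b\<in>B. c b *\<^sub>R b)) ((T ^^ i) (fst z)) \<noteq> (v + (\<Sum>b\<in>B. c b *\<^sub>R b)) ((T ^^ i) (snd z))"
      unfolding eq right_minus_eq .
  qed
qed

lemma AE_delay_map_inj_on:
  fixes U A :: "(real ^ 'n) set" and v :: "real ^ 'n \<Rightarrow> real"
  assumes fB: "finite B" and Blip: "\<And>b. b \<in> B \<Longrightarrow> locally_lipschitz_on U b"
    and vlip: "locally_lipschitz_on U v"
    and Tlip: "locally_lipschitz_on U T" and inj: "inj_on T U" and TU: "T ` U \<subseteq> U"
    and AU: "A \<subseteq> U" and dim: "has_boxdim A d" "2 * d < real m"
    and per: "periodic_point_assumption T m A"
    and sep: "separates_points (2 * m) U (span B)"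
  shows "AE c in Pi\<^sub>M B (\<lambda>_. lborel). inj_on (delay_map (v + (\<Sum>b\<in>B. c b *\<^sub>R b)) T m) A"
proof -
  have m0: "m > 0" using has_boxdim_nonneg[OF dim(1)] dim(2) by (cases m) auto
  \<comment> \<open>\<open>P p\<close> is the set of points of minimal period \<open>p\<close>, except that \<open>P m\<close> also takes all
    points of larger or no period.\<close>
  define P where "P p = {x \<in> A. (\<forall>s. 0 < s \<longrightarrow> s < p \<longrightarrow> (T ^^ s) x \<noteq> x) \<and> (p < m \<longrightarrow> (T ^^ p) x = x)}" for p
  have PA: "P p \<subseteq> A" for p by (auto simp: P_def)
  have PD: "x \<in> U" "\<And>s. 0 < s \<Longrightarrow> s < p \<Longrightarrow> (T ^^ s) x \<noteq> x" "p < m \<Longrightarrow> (T ^^ p) x = x" if "x \<in> P p" for x p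
    using that AU by (auto simp: P_def)
  \<comment> \<open>For \<open>p = m\<close> the bound is \<open>2 * d < m\<close>; below
    \<open>m\<close> it comes from the periodic point assumption.\<close>
  have Pcov: "\<exists>s < real p / 2. box_covered s (P p)" if p: "p \<in> {1..m}" for p
  proof (cases "p = m")
    case True
    obtain s where s: "d < s" "s < real m / 2" using dense[of d "real m / 2"] dim(2) by auto
    then show ?thesis using box_covered_subset[OF has_boxdim_imp_box_covered[OF dim(1)] PA] True by blast
  next
    case False
    then have sub: "P p \<subseteq> periodic_points T A p" using p by (auto simp: P_def periodic_points_def)
    show ?thesis
    proof (cases "periodic_points T A p = {}")
      case True
      then have "P p = {}" using sub by simp
      then show ?thesis using p box_covered_empty[of 0] by (intro exI[of _ 0]) auto
    next
      case False
      then obtain d' where d': "has_boxdim (periodic_points T A p) d'" "d' < real p / 2"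
        using per p unfolding periodic_point_assumption_def by blast
      obtain s where s: "d' < s" "s < real p / 2" using dense[OF d'(2)] by auto
      then show ?thesis using box_covered_subset[OF has_boxdim_imp_box_covered[OF d'(1)] sub] by blast
    qed
  qed
  have cover: "\<exists>p\<in>{1..m}. x \<in> P p" if x: "x \<in> A" for x
  proof -
    define p where "p = (LEAST p. 0 < p \<and> (p = m \<or> (T ^^ p) x = x))"
    have p: "0 < p \<and> (p = m \<or> (T ^^ p) x = x)" unfolding p_def by (rule LeastI[of _ m]) (use m0 in simp)
    have "p \<le> m" unfolding p_def by (rule Least_le) (use m0 in simp)
    moreover have "(T ^^ s) x \<noteq> x" if "0 < s" "s < p" for s
      using not_less_Least[OF that(2)[unfolded p_def]] that(1) by blast
    ultimately show ?thesis using p x by (intro bexI[of _ p]) (auto simp: P_def)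
  qed
  let ?y = "\<lambda>c. v + (\<Sum>b\<in>B. c b *\<^sub>R b)"
  let ?sep = "\<lambda>c r z. \<exists>i<r. ?y c ((T ^^ i) (fst z)) \<noteq> ?y c ((T ^^ i) (snd z))"
  let ?L = "Pi\<^sub>M B (\<lambda>_. lborel :: real measure)"
  \<comment> \<open>Used for \<open>p \<le> q\<close> only: the second point lies in the class of
    larger index, so its first \<open>q\<close> iterates are distinct.\<close>
  define Z1 where "Z1 p q = {z \<in> P p \<times> P q. \<forall>i<q. \<forall>k<q. (T ^^ i) (snd z) \<noteq> (T ^^ k) (fst z)}" for p q
  \<comment> \<open>A graph over a single class, hence as thin as the class itself; half of the
    differences suffice for it.\<close>
  define Z2 where "Z2 p j = (\<lambda>x. (x, (T ^^ j) x)) ` P p" for p j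
  have AE1: "AE c in ?L. \<forall>z\<in>Z1 p q. ?sep c q z" if pq: "p \<in> {1..m}" "q \<in> {1..m}" "p \<le> q" for p q
  proof (rule AE_observable_separates_pairs[OF fB Blip vlip Tlip TU])
    show "Z1 p q \<subseteq> U \<times> U" using PA AU by (fastforce simp: Z1_def)
    obtain s where s: "s < real p / 2" "box_covered s (P p)" using Pcov[OF pq(1)] by blast
    obtain t where t: "t < real q / 2" "box_covered t (P q)" using Pcov[OF pq(2)] by blast
    have "s + t < real q" using s(1) t(1) pq(3) by simp
    then have "thin q (P p \<times> P q)" by (rule box_covered_imp_thin[OF box_covered_Times[OF s(2) t(2)]])
    then have "thin q (UNIV \<inter> Z1 p q)" by (rule thin_subset) (auto simp: Z1_def)
    then show "\<exists>W. open W \<and> z \<in> W \<and> thin q (W \<inter> Z1 p q)" for z by blast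
    fix z assume z: "z \<in> Z1 p q"
    then have zP: "fst z \<in> P p" "snd z \<in> P q" by (auto simp: Z1_def)
    show "\<exists>g. \<forall>k<q. g k \<in> span B \<and>
      (\<forall>i<q. g k ((T ^^ i) (fst z)) - g k ((T ^^ i) (snd z)) = (if i = k then 1 else 0))"
    proof (rule dual_system_disjoint_orbits[OF sep _ subspace_span TU])
      show "2 * q \<le> 2 * m" using pq by simp
      show zU: "fst z \<in> U" "snd z \<in> U" using PD(1) zP by auto
      have "(T ^^ i) (snd z) \<noteq> (T ^^ k) (snd z)" if "i < k" "k < q" for i k
      proof
        assume "(T ^^ i) (snd z) = (T ^^ k) (snd z)"
        then have "(T ^^ (k - i)) (snd z) = snd z"
          using that by (intro funpow_eq_imp_periodic[OF inj TU zU(2) zU(2), of i]) simp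
        then show False using PD(2)[OF zP(2), of "k - i"] that by simp
      qed
      then show "inj_on (\<lambda>i. (T ^^ i) (snd z)) {..<q}" by (intro linorder_inj_onI) auto
      show "(T ^^ i) (snd z) \<noteq> (T ^^ k) (fst z)" if "i < q" "k < q" for i k using z that by (simp add: Z1_def)
    qed
  qed
  have AE2: "AE c in ?L. \<forall>z\<in>Z2 p j. ?sep c ((p + 1) div 2) z" if pj: "p \<in> {1..m}" "0 < j" "j < p" for p j
  proof (rule AE_observable_separates_pairs[OF fB Blip vlip Tlip TU])
    let ?r = "(p + 1) div 2"
    have PU: "P p \<subseteq> U" using PA AU by blast
    show "Z2 p j \<subseteq> U \<times> U" using PU funpow_image_subset[OF TU] by (auto simp: Z2_def)
    obtain s where s: "s < real p / 2" "box_covered s (P p)" using Pcov[OF pj(1)] by blast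
    have "p \<le> 2 * ?r" by simp
    then have "real p \<le> 2 * real ?r" by (metis of_nat_le_iff of_nat_mult of_nat_numeral)
    then have thinP: "thin ?r (P p)" using s by (intro box_covered_imp_thin[OF s(2)]) simp
    fix z assume "z \<in> Z2 p j"
    then obtain x where x: "x \<in> P p" "z = (x, (T ^^ j) x)" by (auto simp: Z2_def)
    show "\<exists>W. open W \<and> z \<in> W \<and> thin ?r (W \<inter> Z2 p j)"
    proof -
      \<comment> \<open>The iterate is only locally Lipschitz, so the graph is shown to be thin near
        each of its points rather than as a whole.\<close>
      obtain V L where V: "open V" "x \<in> V" "L-lipschitz_on (V \<inter> U) (T ^^ j)"
        using locally_lipschitz_on_funpow[OF Tlip TU, of j] PD(1)[OF x(1)] unfolding locally_lipschitz_on_def by blast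
      have "L-lipschitz_on (V \<inter> P p) (T ^^ j)" by (rule lipschitz_on_subset[OF V(3)]) (use PU in auto)
      then have "(sqrt (1\<^sup>2 + L\<^sup>2))-lipschitz_on (V \<inter> P p) (\<lambda>x. (x, (T ^^ j) x))"
        by (intro lipschitz_on_Pair lipschitz_intros)
      then have "thin ?r ((\<lambda>x. (x, (T ^^ j) x)) ` (V \<inter> P p))"
        by (rule thin_lipschitz_image[OF thin_subset[OF thinP Int_lower2]])
      then have "thin ?r ((V \<times> UNIV) \<inter> Z2 p j)" by (rule thin_subset) (auto simp: Z2_def)
      then show ?thesis using V(1,2) x(2) by (intro exI[of _ "V \<times> UNIV"]) (auto intro: open_Times)
    qed
    show "\<exists>g. \<forall>k<?r. g k \<in> span B \<and>
      (\<forall>i<?r. g k ((T ^^ i) (fst z)) - g k ((T ^^ i) (snd z)) = (if i = k then 1 else 0))"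
      unfolding x(2) fst_conv snd_conv
      by (rule dual_system_same_orbit[OF sep _ subspace_span inj TU PD(1)[OF x(1)] PD(2)[OF x(1)] pj(2,3)])
         (use pj in auto)
  qed
  have "AE c in ?L. \<forall>p\<in>{1..m}. \<forall>q\<in>{p..m}. \<forall>z\<in>Z1 p q. ?sep c q z"
    using AE1 by (subst AE_ball_countable, simp, intro ballI, subst AE_ball_countable, simp, intro ballI) simp
  moreover have "AE c in ?L. \<forall>p\<in>{1..m}. \<forall>j\<in>{1..<p}. \<forall>z\<in>Z2 p j. ?sep c ((p + 1) div 2) z"
    using AE2 by (subst AE_ball_countable, simp, intro ballI, subst AE_ball_countable, simp, intro ballI) simp
  ultimately show ?thesis
  proof (rule eventually_elim2)
    fix c assume H1: "\<forall>p\<in>{1..m}. \<forall>q\<in>{p..m}. \<forall>z\<in>Z1 p q. ?sep c q z"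
      and H2: "\<forall>p\<in>{1..m}. \<forall>j\<in>{1..<p}. \<forall>z\<in>Z2 p j. ?sep c ((p + 1) div 2) z"
    have sep2: False if p: "p \<in> {1..m}" "0 < j" "j < p" and x: "x \<in> P p"
      and eq: "\<And>i. i < m \<Longrightarrow> ?y c ((T ^^ i) x) = ?y c ((T ^^ i) ((T ^^ j) x))" for p j x
    proof -
      have "(x, (T ^^ j) x) \<in> Z2 p j" using x by (auto simp: Z2_def)
      moreover have "j \<in> {1..<p}" using p by simp
      ultimately have "?sep c ((p + 1) div 2) (x, (T ^^ j) x)" using H2 p(1) by blast
      then obtain i where i: "i < (p + 1) div 2" "?y c ((T ^^ i) x) \<noteq> ?y c ((T ^^ i) ((T ^^ j) x))" by auto
      have "i < m" using i(1) p(1) by auto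
      then show False using eq i(2) by blast
    qed
    have main: "x = x'" if p: "p \<in> {1..m}" "q \<in> {1..m}" "p \<le> q" and x: "x \<in> P p" "x' \<in> P q"
      and eq: "\<And>i. i < m \<Longrightarrow> ?y c ((T ^^ i) x) = ?y c ((T ^^ i) x')" for p q x x'
    proof (rule ccontr)
      assume ne: "x \<noteq> x'"
      have xU: "x \<in> U" "x' \<in> U" using PD(1) x by auto
      show False
      proof (cases "(x, x') \<in> Z1 p q")
        case True
        moreover have "q \<in> {p..m}" using p by simp
        ultimately have "?sep c q (x, x')" using H1 p(1) by blast
        then obtain i where i: "i < q" "?y c ((T ^^ i) x) \<noteq> ?y c ((T ^^ i) x')" by auto
        then show False using eq[of i] p(2) by simp
      next
        case False
        then obtain i k where ik: "i < q" "k < q" "(T ^^ i) x' = (T ^^ k) x" using x by (auto simp: Z1_def)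
        consider "i = k" | "i < k" | "k < i" by linarith
        then show False
        proof cases
          case 1
          then have "(T ^^ 0) x = x'" using ik(3) by (intro funpow_eq_imp_periodic[OF inj TU xU, of i]) simp
          then show False using ne by simp
        next
          case 2
          define j where "j = k - i"
          have j: "(T ^^ j) x = x'" unfolding j_def
            using ik(3) 2 by (intro funpow_eq_imp_periodic[OF inj TU xU, of i]) simp
          have j': "0 < j" "j < q" using 2 ik by (auto simp: j_def)
          show False
          proof (cases "p = q")
            case True
            show False by (rule sep2[OF p(1) j'(1) _ x(1)]) (use True j' j eq in auto)
          next
            \<comment> \<open>Now \<open>x\<close> has period \<open>p\<close>, hence so has its
              iterate \<open>x'\<close>; this contradicts that no period of \<open>x'\<close> is
              below \<open>q\<close>.\<close>
            case False
            then have pq: "p < q" "p < m" "0 < p" using p by auto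
            have "(T ^^ p) x' = (T ^^ (p + j)) x" by (simp add: funpow_add j[symmetric])
            also have "\<dots> = (T ^^ j) ((T ^^ p) x)" by (simp add: add.commute[of p] funpow_add)
            also have "\<dots> = x'" using PD(3)[OF x(1) pq(2)] j by simp
            finally show False using PD(2)[OF x(2) pq(3,1)] by simp
          qed
        next
          \<comment> \<open>Here the pair starts at \<open>x'\<close>, whose class is
            \<open>q\<close>, and \<open>j < q\<close> is just what \<open>Z2 q j\<close> requires;
            no comparison of \<open>p\<close> with \<open>q\<close> is needed.\<close>
          case 3
          define j where "j = i - k"
          have j: "(T ^^ j) x' = x" unfolding j_def
            using ik(3) 3 by (intro funpow_eq_imp_periodic[OF inj TU xU(2,1), of k]) simp
          have j': "0 < j" "j < q" using 3 ik by (auto simp: j_def)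
          show False
            by (rule sep2[OF p(2) j' x(2)]) (use j eq in auto)
        qed
      qed
    qed
    show "inj_on (delay_map (?y c) T m) A"
    proof (rule inj_onI)
      fix x x' assume xA: "x \<in> A" "x' \<in> A" and e: "delay_map (?y c) T m x = delay_map (?y c) T m x'"
      have eq: "?y c ((T ^^ i) x) = ?y c ((T ^^ i) x')" if "i < m" for i
        using fun_cong[OF e, of i] that by (simp add: delay_map_def)
      obtain p where p: "p \<in> {1..m}" "x \<in> P p" using cover[OF xA(1)] by blast
      obtain q where q: "q \<in> {1..m}" "x' \<in> P q" using cover[OF xA(2)] by blast
      show "x = x'"
      proof (cases "p \<le> q")
        case True
        then show ?thesis by (rule main[OF p(1) q(1) _ p(2) q(2) eq])
      next
        case False
        then show ?thesis using main[OF q(1) p(1) _ q(2) p(2) eq[symmetric]] by simp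
      qed
    qed
  qed
qed

section \<open>Injectivity as a Borel condition on the observable\<close>

lemma C1_on_imp_continuous_on:
  assumes "C1_on U f" shows "continuous_on U f"
proof -
  obtain f' where "\<And>x. x \<in> U \<Longrightarrow> (f has_derivative blinfun_apply (f' x)) (at x)"
    using assms unfolding C1_on_def by blast
  then show ?thesis by (intro continuous_at_imp_continuous_on ballI has_derivative_continuous) blast
qed

lemma continuous_on_funpow:
  assumes "continuous_on U T" "T ` U \<subseteq> U"
  shows "continuous_on U (T ^^ i)"
proof (induction i)
  case (Suc i)
  have "continuous_on U (T \<circ> (T ^^ i))"
    by (rule continuous_on_compose[OF Suc continuous_on_subset[OF assms(1)]])
       (use funpow_image_subset[OF assms(2)] in blast)
  then show ?case by simp
qed (simp add: id_def)

text \<open>The sum \<open>f\<close> of the absolute differences is continuous and positive on the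
  compact \<open>K\<close>, hence bounded away from 0. Changing \<open>y\<close> by less than
  \<open>e\<close> on the compact set of all iterates involved moves each of the \<open>m\<close>
  differences by less than \<open>2 * e\<close>.\<close>

lemma openin_C1_topology_separating:
  fixes U :: "(real ^ 'n) set"
  assumes T: "continuous_on U T" "T ` U \<subseteq> U" and K: "compact K" "K \<subseteq> U \<times> U"
  shows "openin (C1_topology U)
    {y \<in> C1_space U. \<forall>z\<in>K. \<exists>i<m. y ((T ^^ i) (fst z)) \<noteq> y ((T ^^ i) (snd z))}" (is "openin _ ?S")
  unfolding openin_C1_topology
proof (intro conjI ballI)
  fix y assume y: "y \<in> ?S"
  have yc: "continuous_on U y" using y C1_on_imp_continuous_on by (auto simp: C1_space_def)
  define f where "f z = (\<Sum>i<m. \<bar>y ((T ^^ i) (fst z)) - y ((T ^^ i) (snd z))\<bar>)" for z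
  have TiU: "(T ^^ i) x \<in> U" if "x \<in> U" for i x using funpow_image_subset[OF T(2) that] .
  have K1: "compact (fst ` K)" "fst ` K \<subseteq> U" "compact (snd ` K)" "snd ` K \<subseteq> U"
    using K by (auto intro!: compact_continuous_image continuous_intros)
  define K' where "K' = (\<Union>i\<in>{..<m}. (T ^^ i) ` (fst ` K \<union> snd ` K))"
  have "compact ((T ^^ i) ` (fst ` K \<union> snd ` K))" for i
    by (rule compact_continuous_image[OF continuous_on_subset[OF continuous_on_funpow[OF T]]
          compact_Un[OF K1(1,3)]]) (use K1(2,4) in blast)
  then have "compact K'" unfolding K'_def by (intro compact_UN) auto
  moreover have "K' \<subseteq> U" using K1(2,4) TiU unfolding K'_def by blast
  moreover obtain e where e: "e > 0" "\<And>z. z \<in> K \<Longrightarrow> 2 * real m * e < f z"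
  proof (cases "K = {}")
    case True
    then show ?thesis using that[of 1] by simp
  next
    case False
    have yT: "continuous_on U (\<lambda>x. y ((T ^^ i) x))" for i
      by (rule continuous_on_compose2[OF yc continuous_on_funpow[OF T]]) (use TiU in blast)
    have "continuous_on K f" unfolding f_def
      by (intro continuous_intros continuous_on_compose2[OF yT]) (use K1 in auto)
    then obtain z0 where z0: "z0 \<in> K" "\<forall>z\<in>K. f z0 \<le> f z"
      using continuous_attains_inf[OF K(1) False] by blast
    obtain i where i: "i < m" "y ((T ^^ i) (fst z0)) \<noteq> y ((T ^^ i) (snd z0))" using y z0(1) by blast
    have "0 < \<bar>y ((T ^^ i) (fst z0)) - y ((T ^^ i) (snd z0))\<bar>" using i(2) by simp
    also have "\<dots> \<le> f z0" unfolding f_def using i(1) by (intro member_le_sum) auto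
    finally have f0: "f z0 > 0" .
    \<comment> \<open>The extra 1 makes \<open>2 * m * e < f z0\<close> strict.\<close>
    define e where "e = f z0 / (2 * real m + 1)"
    have "e > 0" using f0 by (simp add: e_def)
    moreover have "(2 * real m + 1) * e = f z0" by (simp add: e_def add_nonneg_eq_0_iff)
    then have "2 * real m * e < f z0" using \<open>e > 0\<close> by (simp add: distrib_right)
    then have "2 * real m * e < f z" if "z \<in> K" for z using z0(2) that by force
    ultimately show ?thesis using that by blast
  qed
  moreover have "C1_nbhd U K' e y \<subseteq> ?S"
  proof
    fix g assume g: "g \<in> C1_nbhd U K' e y"
    have close: "\<bar>g x - y x\<bar> < e" if "x \<in> K'" for x using g that by (auto simp: C1_nbhd_def)
    have "\<exists>i<m. g ((T ^^ i) (fst z)) \<noteq> g ((T ^^ i) (snd z))" if z: "z \<in> K" for z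
    proof (rule ccontr)
      assume "\<not> ?thesis"
      then have eq: "g ((T ^^ i) (fst z)) = g ((T ^^ i) (snd z))" if "i < m" for i using that by blast
      have "\<bar>y ((T ^^ i) (fst z)) - y ((T ^^ i) (snd z))\<bar> \<le> 2 * e" if i: "i < m" for i
      proof -
        have "(T ^^ i) (fst z) \<in> K'" "(T ^^ i) (snd z) \<in> K'" using i z by (auto simp: K'_def)
        then show ?thesis using close[of "(T ^^ i) (fst z)"] close[of "(T ^^ i) (snd z)"] eq[OF i] by linarith
      qed
      then have "f z \<le> (\<Sum>i<m. 2 * e)" unfolding f_def by (intro sum_mono) auto
      then show False using e(2)[OF z] by simp
    qed
    moreover have "g \<in> C1_space U" using g by (simp add: C1_nbhd_def)
    ultimately show "g \<in> ?S" by simp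
  qed
  ultimately show "\<exists>K e. compact K \<and> K \<subseteq> U \<and> 0 < e \<and> C1_nbhd U K e y \<subseteq> ?S" by blast
qed auto

text \<open>Distinct pairs do not form a compact set, but pairs at distance at least
  \<open>1 / Suc n\<close> do, and separating these is an open condition. Injectivity is the
  conjunction over all \<open>n\<close>.\<close>

lemma borel_delay_map_inj_on:
  fixes U A :: "(real ^ 'n) set"
  assumes T: "continuous_on U T" "T ` U \<subseteq> U" and A: "compact A" "A \<subseteq> U"
  shows "{y \<in> C1_space U. inj_on (delay_map y T m) A} \<in>
    sigma_sets (topspace (C1_topology U)) {G. openin (C1_topology U) G}" (is "?S \<in> ?M")
proof -
  define K where "K n = A \<times> A \<inter> {z. 1 / Suc n \<le> dist (fst z) (snd z)}" for n :: nat
  define G where "G n = {y \<in> C1_space U. \<forall>z\<in>K n. \<exists>i<m. y ((T ^^ i) (fst z)) \<noteq> y ((T ^^ i) (snd z))}" for n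
  have "compact (K n)" for n unfolding K_def
    using A(1) by (intro compact_Int_closed compact_Times closed_Collect_le continuous_intros)
  moreover have "K n \<subseteq> U \<times> U" for n using A(2) by (auto simp: K_def)
  ultimately have G: "G n \<in> ?M" for n
    unfolding G_def by (intro sigma_sets.Basic CollectI openin_C1_topology_separating[OF T])
  have delay: "delay_map y T m x = delay_map y T m x' \<longleftrightarrow> (\<forall>i<m. y ((T ^^ i) x) = y ((T ^^ i) x'))" for y x x'
    by (auto simp: delay_map_def restrict_def fun_eq_iff)
  have "?S = (\<Inter>n. G n)"
  proof (intro set_eqI iffI)
    fix y assume y: "y \<in> ?S"
    have "y \<in> G n" for n
    proof -
      have "\<exists>i<m. y ((T ^^ i) (fst z)) \<noteq> y ((T ^^ i) (snd z))" if z: "z \<in> K n" for z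
      proof -
        have "fst z \<in> A" "snd z \<in> A" using z by (auto simp: K_def)
        moreover have "0 < 1 / real (Suc n)" by simp
        then have "fst z \<noteq> snd z" using z unfolding K_def by force
        ultimately have "delay_map y T m (fst z) \<noteq> delay_map y T m (snd z)" using y by (auto dest: inj_onD)
        then show ?thesis unfolding delay by blast
      qed
      then show ?thesis using y by (simp add: G_def)
    qed
    then show "y \<in> (\<Inter>n. G n)" by blast
  next
    fix y assume y: "y \<in> (\<Inter>n. G n)"
    have "inj_on (delay_map y T m) A"
    proof (rule inj_onI, rule ccontr)
      fix x x' assume x: "x \<in> A" "x' \<in> A" "delay_map y T m x = delay_map y T m x'" "x \<noteq> x'"
      obtain n where "1 / real (Suc n) < dist x x'"
        using reals_Archimedean[of "dist x x'"] x(4) by (auto simp: inverse_eq_divide)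
      then have "(x, x') \<in> K n" using x by (simp add: K_def)
      moreover have "y \<in> G n" using y by blast
      ultimately have "\<exists>i<m. y ((T ^^ i) (fst (x, x'))) \<noteq> y ((T ^^ i) (snd (x, x')))" unfolding G_def by blast
      then show False using x(3) unfolding delay by auto
    qed
    moreover have "y \<in> C1_space U" using y unfolding G_def by blast
    ultimately show "y \<in> ?S" by simp
  qed
  moreover have "(\<Inter>n. G n) \<in> ?M"
    using G by (intro sigma_sets_Inter) (auto dest: openin_subset)
  ultimately show ?thesis by simp
qed

section \<open>Conjugacy from equal delay measures\<close>

lemma funpow_measurable:
  fixes U :: "'a::topological_space set"
  assumes M: "borel_prob_on U M" and y: "continuous_on U y" and T: "continuous_on U T" "T ` U \<subseteq> U"
  shows "(\<lambda>x. y ((T ^^ i) x) :: real) \<in> borel_measurable M"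
proof -
  have "continuous_on U (\<lambda>x. y ((T ^^ i) x))"
    by (rule continuous_on_compose2[OF y continuous_on_funpow[OF T]]) (use funpow_image_subset[OF T(2)] in blast)
  then have "(\<lambda>x. y ((T ^^ i) x)) \<in> borel_measurable (restrict_space borel U)"
    by (rule borel_measurable_continuous_on_restrict)
  then show ?thesis using M by (simp add: borel_prob_on_def cong: measurable_cong_sets)
qed

lemma delay_map_measurable:
  fixes U :: "'a::topological_space set"
  assumes M: "borel_prob_on U M" and y: "continuous_on U y" and T: "continuous_on U T" "T ` U \<subseteq> U"
  shows "delay_map y T k \<in> measurable M (Pi\<^sub>M {..<k} (\<lambda>_. borel))"
  unfolding delay_map_def using funpow_measurable[OF assms] by (intro measurable_restrict)

lemma open_support_pos:
  fixes M :: "'a::second_countable_topology measure"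
  assumes M: "borel_prob_on U M" and x: "x \<in> supp M" and W: "openin (top_of_set U) W" "x \<in> W"
  shows "emeasure M W > 0"
proof (rule ccontr)
  assume "\<not> ?thesis"
  then have W0: "emeasure M W = 0" by simp
  interpret prob_space M using M by (simp add: borel_prob_on_def)
  have sp: "space M = U" "sets M = sets (restrict_space borel U)" using M by (auto simp: borel_prob_on_def)
  obtain V where V: "open V" "W = U \<inter> V" using W(1) by (auto simp: openin_open)
  have Wm: "W \<in> sets M" unfolding sp(2) using V by (auto simp: sets_restrict_space)
  have "emeasure M (U - W) = 1"
    using emeasure_compl[OF Wm] W0 emeasure_space_1 sp(1) by simp
  moreover have "closedin (top_of_set U) (U - W)" using W(1) by (simp add: closedin_diff)
  ultimately have "supp M \<subseteq> U - W"
    using is_support_supp[OF M] sp(1) unfolding is_support_def by blast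
  then show False using x W(2) by blast
qed

text \<open>The preimage of the support is relatively closed by continuity and has full measure by
  invariance; the support lies in every such set.\<close>

lemma supp_invariant:
  fixes M :: "'a::second_countable_topology measure"
  assumes M: "borel_prob_on U M" and T: "continuous_on U T" "T ` U \<subseteq> U" and inv: "invariant_measure T M"
  shows "T ` supp M \<subseteq> supp M"
proof -
  have sp: "space M = U" "sets M = sets (restrict_space borel U)" using M by (auto simp: borel_prob_on_def)
  have s: "closedin (top_of_set U) (supp M)" "emeasure M (supp M) = 1"
    "\<And>D. closedin (top_of_set U) D \<Longrightarrow> emeasure M D = 1 \<Longrightarrow> supp M \<subseteq> D"
    using is_support_supp[OF M] sp(1) unfolding is_support_def by auto
  have sm: "supp M \<in> sets M"
    using s(2) emeasure_notin_sets by fastforce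
  have cl: "closedin (top_of_set U) (U \<inter> T -` supp M)"
    by (rule continuous_closedin_preimage_gen[OF T(1) _ s(1)]) (use T(2) in auto)
  have "emeasure M (T -` supp M \<inter> space M) = emeasure (distr M M T) (supp M)"
    using inv by (intro emeasure_distr[symmetric] sm) (simp add: invariant_measure_def)
  also have "\<dots> = 1" using inv s(2) by (simp add: invariant_measure_def)
  finally have "emeasure M (U \<inter> T -` supp M) = 1" using sp(1) by (simp add: Int_commute)
  then show ?thesis using s(3)[OF cl] by blast
qed

text \<open>If the delay vector of \<open>x\<close> missed the compact image of
  \<open>supp N\<close>, so would a ball around it. The preimage of the ball under the first delay
  map is an open neighbourhood of \<open>x\<close>, of positive measure; its preimage under the
  second misses \<open>supp N\<close> and is null.\<close>

lemma delay_measure_eq_imp_image_subset: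
  fixes M N :: "'a::{second_countable_topology} measure"
  assumes M: "borel_prob_on U M" and N: "borel_prob_on U N"
    and T: "continuous_on U T" "T ` U \<subseteq> U" and S: "continuous_on U S" "S ` U \<subseteq> U"
    and y: "continuous_on U y" and sM: "supp M \<subseteq> U" and sN: "compact (supp N)" "supp N \<subseteq> U"
    and eq: "delay_measure y T k M = delay_measure y S k N"
  shows "delay_map y T k ` supp M \<subseteq> delay_map y S k ` supp N"
proof (rule image_subsetI, rule ccontr)
  fix x assume x: "x \<in> supp M" and nin: "delay_map y T k x \<notin> delay_map y S k ` supp N"
  let ?w = "delay_map y T k x"
  let ?P = "Pi\<^sub>M {..<k} (\<lambda>_. borel :: real measure)"
  have yc: "continuous_on U (\<lambda>x. y ((R ^^ i) x))" if "continuous_on U R" "R ` U \<subseteq> U" for R i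
    by (rule continuous_on_compose2[OF y continuous_on_funpow[OF that]])
       (use funpow_image_subset[OF that(2)] in blast)
  \<comment> \<open>The l1 distance of a delay vector from that of \<open>x\<close>: continuous in
    the point, and measurable in the vector for the product sigma-algebra.\<close>
  define f where "f R x' = (\<Sum>i<k. \<bar>y ((R ^^ i) x') - ?w i\<bar>)" for R :: "'a \<Rightarrow> 'a" and x'
  have fc: "continuous_on U (f R)" if "continuous_on U R" "R ` U \<subseteq> U" for R
    unfolding f_def by (intro continuous_intros yc[OF that])
  have fx: "f T x = 0" by (simp add: f_def delay_map_def)
  have pos: "f S x' > 0" if x': "x' \<in> supp N" for x'
  proof (rule ccontr)
    assume "\<not> ?thesis"
    moreover have "f S x' \<ge> 0" unfolding f_def by (intro sum_nonneg) auto
    ultimately have "f S x' = 0" by simp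
    then have "\<forall>i<k. y ((S ^^ i) x') = ?w i" unfolding f_def by (subst (asm) sum_nonneg_eq_0_iff) auto
    then have "delay_map y S k x' = ?w" by (auto simp: delay_map_def restrict_def fun_eq_iff)
    then show False using nin x' by (metis imageI)
  qed
  obtain e where e: "e > 0" "\<And>x'. x' \<in> supp N \<Longrightarrow> e \<le> f S x'"
  proof (cases "supp N = {}")
    case True
    then show ?thesis using that[of 1] by simp
  next
    case False
    obtain z where "z \<in> supp N" "\<forall>x'\<in>supp N. f S z \<le> f S x'"
      using continuous_attains_inf[OF sN(1) False continuous_on_subset[OF fc[OF S] sN(2)]] by blast
    then show ?thesis using that[of "f S z"] pos by blast
  qed
  define V where "V = {w \<in> space ?P. (\<Sum>i<k. \<bar>w i - ?w i\<bar>) < e}"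
  have "(\<lambda>w. \<Sum>i<k. \<bar>w i - ?w i\<bar>) \<in> borel_measurable ?P"
    by (intro borel_measurable_sum borel_measurable_abs borel_measurable_diff measurable_component_singleton) auto
  then have Vm: "V \<in> sets ?P" unfolding V_def by measurable
  have pre: "delay_map y R k -` V \<inter> U = {x' \<in> U. f R x' < e}" for R
    by (auto simp: V_def f_def delay_map_def space_PiM)
  have sp: "space M = U" "space N = U" using M N by (auto simp: borel_prob_on_def)
  have "openin (top_of_set U) {x' \<in> U. f T x' < e}"
  proof -
    have "{x' \<in> U. f T x' < e} = U \<inter> f T -` {..<e}" by auto
    then show ?thesis using continuous_openin_preimage_gen[OF fc[OF T] open_lessThan] by metis
  qed
  then have "emeasure M {x' \<in> U. f T x' < e} > 0"
    by (rule open_support_pos[OF M x]) (use x sM fx e(1) in auto)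
  also have "emeasure M {x' \<in> U. f T x' < e} = emeasure (delay_measure y T k M) V"
    unfolding delay_measure_def using Vm delay_map_measurable[OF M y T] by (simp add: emeasure_distr pre sp)
  also have "\<dots> = emeasure N {x' \<in> U. f S x' < e}"
    unfolding eq unfolding delay_measure_def using Vm delay_map_measurable[OF N y S]
    by (simp add: emeasure_distr pre sp)
  finally have p: "emeasure N {x' \<in> U. f S x' < e} > 0" .
  interpret N: prob_space N using N by (simp add: borel_prob_on_def)
  have s1: "emeasure N (supp N) = 1" using is_support_supp[OF N] by (simp add: is_support_def)
  then have sm: "supp N \<in> sets N" using emeasure_notin_sets by fastforce
  have "{x' \<in> U. f S x' < e} \<subseteq> U - supp N" using e(2) by force
  then have "emeasure N {x' \<in> U. f S x' < e} \<le> emeasure N (U - supp N)"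
    using sm sp(2) by (intro emeasure_mono) (auto dest: sets.compl_sets)
  also have "\<dots> = 0" using emeasure_compl[OF sm] s1 N.emeasure_space_1 sp(2) by simp
  finally show False using p by simp
qed

lemma homeomorphism_delay_map:
  fixes A :: "'a::metric_space set"
  assumes "compact A" "A \<subseteq> U" "continuous_on U T" "T ` U \<subseteq> U" "continuous_on U y"
    and "inj_on (delay_map y T m) A"
  obtains h where "homeomorphism A (delay_map y T m ` A) (delay_map y T m) h"
proof -
  have "continuous_on U (\<lambda>x. y ((T ^^ i) x))" for i
    by (rule continuous_on_compose2[OF assms(5) continuous_on_funpow[OF assms(3,4)]])
       (use funpow_image_subset[OF assms(4)] in blast)
  then have *: "continuous_on A (\<lambda>x. y ((T ^^ i) x))" for i using assms(2) continuous_on_subset by blast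
  \<comment> \<open>From index \<open>m\<close> on the delay vector is constantly
    \<open>undefined\<close>, so these coordinates are continuous as well.\<close>
  have "continuous_on A (\<lambda>x. delay_map y T m x i)" for i
    unfolding delay_map_def restrict_def using * by (cases "i < m") auto
  then have "continuous_on A (delay_map y T m)" by (rule continuous_on_coordinatewise_then_product)
  then show ?thesis
    using homeomorphism_compact[OF assms(1) _ refl assms(6)] that by blast
qed

lemma delay_measure_eq_imp_conjugate:
  fixes M N :: "'a::{second_countable_topology,metric_space} measure"
  assumes M: "borel_prob_on U M" and N: "borel_prob_on U N"
    and T: "continuous_on U T" "T ` U \<subseteq> U" "invariant_measure T M"
    and S: "continuous_on U S" "S ` U \<subseteq> U" "invariant_measure S N"
    and y: "continuous_on U y"
    and sM: "compact (supp M)" "supp M \<subseteq> U" and sN: "compact (supp N)" "supp N \<subseteq> U"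
    and eq: "delay_measure y T (m + 1) M = delay_measure y S (m + 1) N"
    and injT: "inj_on (delay_map y T m) (supp M)" and injS: "inj_on (delay_map y S m) (supp N)"
  shows "topologically_conjugate (supp M) T (supp N) S"
proof -
  let ?F = "delay_map y T m" and ?G = "delay_map y S m"
  have TM: "T ` supp M \<subseteq> supp M" using supp_invariant[OF M T] .
  have SN: "S ` supp N \<subseteq> supp N" using supp_invariant[OF N S] .
  have img: "delay_map y T (m + 1) ` supp M = delay_map y S (m + 1) ` supp N"
    using delay_measure_eq_imp_image_subset[OF M N T(1,2) S(1,2) y sM(2) sN eq]
      delay_measure_eq_imp_image_subset[OF N M S(1,2) T(1,2) y sN(2) sM eq[symmetric]] by blast
  \<comment> \<open>The first \<open>m\<close> of the \<open>m + 1\<close> delays determine the point, the last \<open>m\<close> its image.\<close>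
  have head: "delay_map y R m x = restrict (delay_map y R (m + 1) x) {..<m}" for R x
    by (auto simp: delay_map_def restrict_def fun_eq_iff)
  have tail: "delay_map y R m (R x) = (\<lambda>i\<in>{..<m}. delay_map y R (m + 1) x (Suc i))" for R x
    by (auto simp: delay_map_def restrict_def fun_eq_iff funpow_swap1)
  have img': "?F ` supp M = ?G ` supp N"
  proof -
    have "?F ` supp M = (\<lambda>w. restrict w {..<m}) ` delay_map y T (m + 1) ` supp M"
      unfolding image_image by (rule image_cong[OF refl head])
    also have "\<dots> = ?G ` supp N" unfolding img image_image by (rule image_cong[OF refl head[symmetric]])
    finally show ?thesis .
  qed
  obtain h1 where h1: "homeomorphism (supp M) (?F ` supp M) ?F h1"
    using homeomorphism_delay_map[OF sM T(1,2) y injT] .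
  obtain h2 where h2: "homeomorphism (supp N) (?G ` supp N) ?G h2"
    using homeomorphism_delay_map[OF sN S(1,2) y injS] .
  \<comment> \<open>The conjugating map sends a point of \<open>supp M\<close> to the point of
    \<open>supp N\<close> with the same delay vector.\<close>
  have hom: "homeomorphism (supp M) (supp N) (h2 \<circ> ?F) (h1 \<circ> ?G)"
    using homeomorphism_compose[OF h1 homeomorphism_symD[OF h2[folded img']]] by simp
  have "S x = (h2 \<circ> ?F) (T ((h1 \<circ> ?G) x))" if x: "x \<in> supp N" for x
  proof -
    obtain x' where x': "x' \<in> supp M" "delay_map y T (m + 1) x' = delay_map y S (m + 1) x"
      using img x by (metis imageE imageI)
    have "?F x' = ?G x" unfolding head x'(2) ..
    then have "(h1 \<circ> ?G) x = x'" using homeomorphism_apply1[OF h1 x'(1)] by simp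
    moreover have "?F (T x') = ?G (S x)" unfolding tail x'(2) ..
    moreover have "S x \<in> supp N" using SN x by blast
    ultimately show ?thesis using homeomorphism_apply1[OF h2] by simp
  qed
  then show ?thesis
    unfolding topologically_conjugate_def
    using hom TM SN continuous_on_subset[OF T(1) sM(2)] continuous_on_subset[OF S(1) sN(2)] by blast
qed

lemma C1_diffeoD:
  assumes "open U" "C1_diffeo U T"
  shows "inj_on T U" "T ` U \<subseteq> U" "continuous_on U T" "locally_lipschitz_on U T"
  using assms C1_on_imp_continuous_on C1_on_imp_locally_lipschitz_on
  by (auto simp: C1_diffeo_def bij_betw_def)

theorem theoremS3p1:
  fixes U :: "(real ^ 'n) set"
    and T S :: "real ^ 'n \<Rightarrow> real ^ 'n"
    and \<mu> \<nu> :: "(real ^ 'n) measure"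
    and d\<mu> d\<nu> :: real
    and m :: nat
  assumes "open U"
    and "C1_diffeo U T" and "C1_diffeo U S"
    and "borel_prob_on U \<mu>" and "borel_prob_on U \<nu>"
    and "invariant_measure T \<mu>" and "invariant_measure S \<nu>"
    and "compact (supp \<mu>)" and "supp \<mu> \<subseteq> U"
    and "compact (supp \<nu>)" and "supp \<nu> \<subseteq> U"
    and "has_boxdim (supp \<mu>) d\<mu>" and "has_boxdim (supp \<nu>) d\<nu>"
    and "real m > 2 * max d\<mu> d\<nu>"
    and "periodic_point_assumption T m (supp \<mu>)"
    and "periodic_point_assumption S m (supp \<nu>)"
  shows "almost_every_in (C1_topology U) (\<lambda>y.
    delay_measure y T (m + 1) \<mu> = delay_measure y S (m + 1) \<nu> \<longrightarrow>
    topologically_conjugate (supp \<mu>) T (supp \<nu>) S)"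
proof -
  note T = C1_diffeoD[OF assms(1,2)] and S = C1_diffeoD[OF assms(1,3)]
  let ?X = "C1_topology U"
  define \<S>\<^sub>T where "\<S>\<^sub>T = {y \<in> C1_space U. inj_on (delay_map y T m) (supp \<mu>)}"
  define \<S>\<^sub>S where "\<S>\<^sub>S = {y \<in> C1_space U. inj_on (delay_map y S m) (supp \<nu>)}"
  interpret sigma_algebra "topspace ?X" "sigma_sets (topspace ?X) {G. openin ?X G}"
    by (rule sigma_algebra_sigma_sets) (auto dest: openin_subset)
  have borel: "\<S>\<^sub>T \<inter> \<S>\<^sub>S \<in> sigma_sets (topspace ?X) {G. openin ?X G}"
    unfolding \<S>\<^sub>T_def \<S>\<^sub>S_def
    by (intro Int borel_delay_map_inj_on[OF T(3,2) assms(8,9)] borel_delay_map_inj_on[OF S(3,2) assms(10,11)])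
  \<comment> \<open>Two orbit segments of length \<open>m\<close> involve at most
    \<open>2 * m\<close> points, hence the degree. \<open>prevalent_in\<close> asks for a basis,
    which is extracted from the generating monomials.\<close>
  obtain B where B: "B \<subseteq> monomials_on U (2 * m)" "independent B" "monomials_on U (2 * m) \<subseteq> span B"
    using maximal_independent_subset[of "monomials_on U (2 * m)"] by blast
  have fB: "finite B" using finite_subset[OF B(1) finite_monomials_on] .
  have spB: "span B = span (monomials_on U (2 * m))"
    using B(1,3) by (metis span_eq span_superset subset_trans)
  have sep: "separates_points (2 * m) U (span B)" unfolding spB by (rule separates_points_span_monomials_on)
  have sub: "subspace (C1_space U)" by (rule subspace_C1_space[OF assms(1)])
  have BC: "B \<subseteq> C1_space U" using B(1) monomials_on_subset_C1_space[OF assms(1)] by blast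
  have spC: "span B \<subseteq> C1_space U" by (rule span_minimal[OF BC sub])
  have lip: "locally_lipschitz_on U f" if "f \<in> C1_space U" for f
    using that by (intro C1_on_imp_locally_lipschitz_on[OF assms(1)]) (simp add: C1_space_def)
  have dim: "2 * d\<mu> < real m" "2 * d\<nu> < real m" using assms(14) by (auto simp: max_def split: if_splits)
  have ae: "AE c in Pi\<^sub>M B (\<lambda>_. lborel). v + (\<Sum>b\<in>B. c b *\<^sub>R b) \<in> \<S>\<^sub>T \<inter> \<S>\<^sub>S" if v: "v \<in> C1_space U" for v
  proof -
    have inC: "v + (\<Sum>b\<in>B. c b *\<^sub>R b) \<in> C1_space U" for c
      using BC by (intro subspace_add[OF sub v] subspace_sum[OF sub] subspace_scale[OF sub]) blast
    have "AE c in Pi\<^sub>M B (\<lambda>_. lborel). inj_on (delay_map (v + (\<Sum>b\<in>B. c b *\<^sub>R b)) T m) (supp \<mu>)"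
      by (rule AE_delay_map_inj_on[OF fB _ lip[OF v] T(4,1,2) assms(9,12) dim(1) assms(15) sep])
         (use lip BC in blast)
    moreover have "AE c in Pi\<^sub>M B (\<lambda>_. lborel). inj_on (delay_map (v + (\<Sum>b\<in>B. c b *\<^sub>R b)) S m) (supp \<nu>)"
      by (rule AE_delay_map_inj_on[OF fB _ lip[OF v] S(4,1,2) assms(11,13) dim(2) assms(16) sep])
         (use lip BC in blast)
    ultimately show ?thesis
      by (rule eventually_elim2) (use inC in \<open>simp add: \<S>\<^sub>T_def \<S>\<^sub>S_def\<close>)
  qed
  have "prevalent_in ?X (\<S>\<^sub>T \<inter> \<S>\<^sub>S)"
    unfolding prevalent_in_def topspace_C1_topology
    using borel[unfolded topspace_C1_topology] fB B(2) spC ae by blast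
  moreover have "delay_measure y T (m + 1) \<mu> = delay_measure y S (m + 1) \<nu> \<longrightarrow>
    topologically_conjugate (supp \<mu>) T (supp \<nu>) S" if y: "y \<in> \<S>\<^sub>T \<inter> \<S>\<^sub>S" for y
  proof
    assume eq: "delay_measure y T (m + 1) \<mu> = delay_measure y S (m + 1) \<nu>"
    have "continuous_on U y" using y C1_on_imp_continuous_on by (auto simp: \<S>\<^sub>T_def C1_space_def)
    moreover have "inj_on (delay_map y T m) (supp \<mu>)" "inj_on (delay_map y S m) (supp \<nu>)"
      using y by (auto simp: \<S>\<^sub>T_def \<S>\<^sub>S_def)
    ultimately show "topologically_conjugate (supp \<mu>) T (supp \<nu>) S"
      using delay_measure_eq_imp_conjugate[OF assms(4,5) T(3,2) assms(6) S(3,2) assms(7) _ assms(8-11) eq] by blast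
  qed
  ultimately show ?thesis unfolding almost_every_in_def by blast
qed

end
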